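(* Let $r$ and $m$ be relatively prime positive integers. Then the set of square-free positive integers which are divisible by no prime congruent to $r$ modulo $m$ has natural density zero.
   Context: For a set $B$ of positive integers and a real number $x$, let $B[x]$ denote the number of elements $t\in B$ with $t\le x$. The natural density of $B$ is $\lim_{x\to\infty} B[x]/x$, when this limit exists. *)

theory Defs
  imports "HOL-Number_Theory.Number_Theory" "HOL-Computational_Algebra.Squarefree"
begin

definition counting :: "nat set \<Rightarrow> real \<Rightarrow> nat" where
  "counting B x = card {t \<in> B. real t \<le> x}"

definition has_natural_density :: "nat set \<Rightarrow> real \<Rightarrow> bool" where
  "has_natural_density B d \<longleftrightarrow> ((\<lambda>x::real. real (counting B x) / x) \<longlongrightarrow> d) at_top"

end

theory Submission
  imports Defs
begin

text \<open>
  Take finitely many primes \<open>p \<equiv> r (mod m)\<close>, with product \<open>Q\<close>. Every member of the given set is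
  prime to \<open>Q\<close>, and the integers prime to \<open>Q\<close> have density
  \<open>\<phi>(Q)/Q = \<Prod>(1 - 1/p) \<le> exp(- \<Sum>1/p)\<close>. So the
  density is zero as soon as \<open>\<Sum>1/p\<close> over all primes \<open>p \<equiv> r (mod m)\<close> diverges
  (\<open>density_zero_of_divergent_prime_reciprocals\<close>). This divergence is Dirichlet's theorem in its
  strong form (\<open>prime_reciprocals_progression_diverge\<close>), and it is proved here in the elementary
  way of Mertens: the estimates are for finite sums, and limits enter only through the value
  \<open>L(1,\<chi>) = \<Sum>\<chi>(n)/n\<close> of a conditionally convergent series and in one step of Monsky's argument
  below.

  Let \<open>\<Lambda>\<close> be the Mangoldt function. Orthogonality of the characters modulo \<open>m\<close>
  (\<open>dchars_select_class\<close>) expresses \<open>\<Sum>\<Lambda>(n)/n\<close> over \<open>n \<le> N\<close>, \<open>n \<equiv> r\<close> by the sums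
  \<open>A(\<chi>) = \<Sum>\<chi>(n)\<Lambda>(n)/n\<close> over \<open>n \<le> N\<close>. The principal character contributes \<open>ln N + O(1)\<close> by
  Mertens' theorem. A nonprincipal \<open>\<chi>\<close> contributes \<open>O(1)\<close> provided that \<open>L(1,\<chi>) \<noteq> 0\<close>
  (\<open>Lambda_sum_bounded\<close>): summing \<open>ln = \<Lambda> * 1\<close> against \<open>\<chi>(n)/n\<close> gives
  \<open>L(1,\<chi>) A(\<chi>) + O(1)\<close> on one side and a bounded sum on the other. Hence the sum over the
  residue class grows like \<open>c ln N\<close> with \<open>c > 0\<close>. Higher prime powers contribute \<open>O(1)\<close>, so
  \<open>\<Sum>ln p/p\<close> over the primes of the class grows like \<open>c ln N\<close>; if \<open>\<Sum>1/p\<close> converged, its tails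
  would be small and \<open>\<Sum>ln p/p\<close> would be \<open>o(ln N)\<close>.

  It remains to see that \<open>L(1,\<chi>) \<noteq> 0\<close> for every nonprincipal \<open>\<chi>\<close>. If it were zero, Moebius
  inversion would give \<open>A(\<chi>) = - ln N + O(1)\<close> (\<open>Lambda_sum_of_zero_L\<close>). When \<open>\<chi>\<^sup>2\<close> is also
  nonprincipal, this contradicts \<open>3 + 4 Re \<chi>(n) + Re \<chi>(n)\<^sup>2 \<ge> 0\<close>, because weighting this inequality
  with \<open>\<Lambda>(n)/n\<close> and summing gives \<open>0 \<le> (3 - 4) ln N + O(1)\<close> (\<open>L_nonzero_of_square\<close>). When \<open>\<chi>\<^sup>2\<close>
  is principal, \<open>\<chi>\<close> is real, and Monsky's argument applies: the Lambert series
  \<open>\<Sum>\<chi>(n) t\<^sup>n/(1 - t\<^sup>n)\<close> has coefficients \<open>\<ge> 0\<close>, and \<open>\<ge> 1\<close> at the squares, so it is unbounded as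
  \<open>t\<close> tends to 1; but \<open>L(1,\<chi>) = 0\<close> would bound it (\<open>L_nonzero_real\<close>).
\<close>

section \<open>Dirichlet characters and their orthogonality\<close>

text \<open>
  A Dirichlet character modulo \<open>m\<close> is a completely multiplicative periodic function on the
  natural numbers whose zeros are exactly the numbers that are not prime to \<open>m\<close>. This makes
  \<open>\<chi> 1 = 1\<close> a consequence.
\<close>

definition dchars :: "nat \<Rightarrow> (nat \<Rightarrow> complex) set" where
  "dchars m = {\<chi>. (\<forall>a b. \<chi> (a * b) = \<chi> a * \<chi> b) \<and> (\<forall>a. \<chi> (a mod m) = \<chi> a) \<and>
                   (\<forall>a. \<chi> a = 0 \<longleftrightarrow> \<not> coprime a m)}"

lemma dchars_mult: "\<chi> \<in> dchars m \<Longrightarrow> \<chi> (a * b) = \<chi> a * \<chi> b"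
  and dchars_mod: "\<chi> \<in> dchars m \<Longrightarrow> \<chi> (a mod m) = \<chi> a"
  and dchars_eq_0_iff: "\<chi> \<in> dchars m \<Longrightarrow> \<chi> a = 0 \<longleftrightarrow> \<not> coprime a m"
  by (auto simp: dchars_def)

lemma dchars_cong: "\<chi> \<in> dchars m \<Longrightarrow> [a = b] (mod m) \<Longrightarrow> \<chi> a = \<chi> b"
  by (metis cong_def dchars_mod)

lemma dchars_1:
  assumes "\<chi> \<in> dchars m"
  shows "\<chi> 1 = 1"
proof -
  have "\<chi> 1 \<noteq> 0"
    using dchars_eq_0_iff[OF assms, of 1] by simp
  moreover have "\<chi> 1 * \<chi> 1 = \<chi> 1"
    using dchars_mult[OF assms, of 1 1] by simp
  ultimately show ?thesis by simp
qed

lemma dchars_power: "\<chi> \<in> dchars m \<Longrightarrow> \<chi> (a ^ k) = \<chi> a ^ k"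
  by (induction k) (simp_all add: dchars_mult dchars_1[simplified])

lemma dchars_power_totient:
  assumes "\<chi> \<in> dchars m" "coprime a m"
  shows "\<chi> a ^ totient m = 1"
proof -
  have "\<chi> a ^ totient m = \<chi> (a ^ totient m)"
    using assms by (simp add: dchars_power)
  also have "\<dots> = \<chi> 1"
    using assms euler_theorem by (intro dchars_cong) auto
  finally show ?thesis using dchars_1[OF assms(1)] by simp
qed

lemma norm_dchars:
  assumes "\<chi> \<in> dchars m" "m > 0" "coprime a m"
  shows "norm (\<chi> a) = 1"
proof -
  have "norm (\<chi> a) ^ totient m = 1"
    using dchars_power_totient[OF assms(1,3)] by (metis norm_one norm_power)
  thus ?thesis
    using assms(2) power_eq_imp_eq_base[of "norm (\<chi> a)" "totient m" 1] by simp
qed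

lemma norm_dchars_le:
  assumes "\<chi> \<in> dchars m" "m > 0"
  shows "norm (\<chi> a) \<le> 1"
  using norm_dchars[OF assms] dchars_eq_0_iff[OF assms(1), of a] by (cases "coprime a m") auto

text \<open>
  A character is determined by its values on \<open>{..<m}\<close>, and these are zero or roots of unity of
  order dividing \<open>\<phi>(m)\<close>.
\<close>

lemma finite_dchars:
  assumes "m > 0"
  shows "finite (dchars m)"
proof (rule finite_subset)
  let ?R = "insert 0 {z::complex. z ^ totient m = 1}"
  let ?F = "PiE {..<m} (\<lambda>_. ?R)"
  show "dchars m \<subseteq> (\<lambda>g a. g (a mod m)) ` ?F"
  proof
    fix \<chi> assume \<chi>: "\<chi> \<in> dchars m"
    have "\<chi> = (\<lambda>a. restrict \<chi> {..<m} (a mod m))"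
      using assms dchars_mod[OF \<chi>] by auto
    moreover have "restrict \<chi> {..<m} \<in> ?F"
      using dchars_power_totient[OF \<chi>] dchars_eq_0_iff[OF \<chi>] by auto
    ultimately show "\<chi> \<in> (\<lambda>g a. g (a mod m)) ` ?F" by blast
  qed
  show "finite ((\<lambda>g a. g (a mod m)) ` ?F)"
    using assms by (intro finite_imageI finite_PiE) (auto simp: finite_roots_unity Suc_leI)
qed

definition principal_char :: "nat \<Rightarrow> nat \<Rightarrow> complex" where
  "principal_char m a = (if coprime a m then 1 else 0)"

lemma principal_char_in_dchars: "principal_char m \<in> dchars m"
  by (cases "m = 0") (simp_all add: dchars_def principal_char_def)

lemma dchars_times:
  assumes "\<chi> \<in> dchars m" "\<psi> \<in> dchars m"
  shows "(\<lambda>a. \<chi> a * \<psi> a) \<in> dchars m"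
  using assms by (auto simp: dchars_def)

lemma dchars_divide:
  assumes "\<chi> \<in> dchars m" "\<psi> \<in> dchars m"
  shows "(\<lambda>a. \<chi> a / \<psi> a) \<in> dchars m"
  using assms by (auto simp: dchars_def)

lemma nonprincipal_witness:
  assumes "\<chi> \<in> dchars m" "\<chi> \<noteq> principal_char m"
  obtains b where "coprime b m" "\<chi> b \<noteq> 1"
proof -
  obtain b where "\<chi> b \<noteq> principal_char m b" using assms(2) by blast
  thus thesis using that[of b] dchars_eq_0_iff[OF assms(1), of b]
    by (auto simp: principal_char_def split: if_splits)
qed

text \<open>
  Multiplication by some \<open>b\<close> with \<open>\<chi> b \<noteq> 1\<close> permutes the residues, so the sum is equal to
  \<open>\<chi> b\<close> times itself.
\<close>

lemma nonprincipal_sum_eq_0: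
  assumes "\<chi> \<in> dchars m" "\<chi> \<noteq> principal_char m" "m > 0"
  shows "(\<Sum>a<m. \<chi> a) = 0"
proof -
  obtain b where b: "coprime b m" "\<chi> b \<noteq> 1"
    using nonprincipal_witness[OF assms(1,2)] .
  have inj: "inj_on (\<lambda>a. b * a mod m) {..<m}"
  proof (rule inj_onI)
    fix x y assume "x \<in> {..<m}" "y \<in> {..<m}" "b * x mod m = b * y mod m"
    moreover from this have "[x = y] (mod m)"
      using b(1) by (metis cong_def cong_mult_lcancel_nat)
    ultimately show "x = y" by (simp add: cong_def)
  qed
  have "(\<lambda>a. b * a mod m) ` {..<m} = {..<m}"
    using assms(3) inj by (intro endo_inj_surj) auto
  hence "(\<Sum>a<m. \<chi> a) = (\<Sum>a<m. \<chi> (b * a mod m))"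
    using sum.reindex[OF inj, of \<chi>] by simp
  also have "\<dots> = \<chi> b * (\<Sum>a<m. \<chi> a)"
    using assms(1) by (simp add: dchars_mod dchars_mult sum_distrib_left)
  finally show ?thesis using b(2) by simp
qed

text \<open>
  Complete periods cancel. An initial sum is therefore at most \<open>m\<close> in absolute value, and a sum
  over an interval is a difference of two initial sums.
\<close>

lemma nonprincipal_sum_bounded:
  assumes "\<chi> \<in> dchars m" "\<chi> \<noteq> principal_char m" "m > 0"
  shows "norm (\<Sum>n\<in>{a..<b}. \<chi> n) \<le> 2 * m"
proof -
  have periods: "(\<Sum>n<q*m. \<chi> n) = 0" for q
  proof (induction q)
    case (Suc q)
    have "(\<Sum>n<Suc q*m. \<chi> n) = (\<Sum>n<q*m. \<chi> n) + (\<Sum>n\<in>{q*m..<q*m+m}. \<chi> n)"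
      by (subst sum.union_disjoint[symmetric]) (auto intro!: sum.cong)
    also have "(\<Sum>n\<in>{q*m..<q*m+m}. \<chi> n) = (\<Sum>n<m. \<chi> (q*m+n))"
      by (rule sum.reindex_bij_witness[of _ "\<lambda>n. q*m+n" "\<lambda>n. n-q*m"]) auto
    also have "\<dots> = (\<Sum>n<m. \<chi> n)"
      by (intro sum.cong dchars_cong[OF assms(1)]) (auto simp: cong_def)
    finally show ?case
      using Suc nonprincipal_sum_eq_0[OF assms] by simp
  qed simp
  have initial: "norm (\<Sum>n<N. \<chi> n) \<le> m" for N
  proof -
    have N: "N div m * m \<le> N" "N < N div m * m + m"
      using div_mult_mod_eq[of N m] mod_less_divisor[OF assms(3), of N] by linarith+
    have "(\<Sum>n<N. \<chi> n) = (\<Sum>n<N div m * m. \<chi> n) + (\<Sum>n\<in>{N div m * m..<N}. \<chi> n)"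
      using N by (subst sum.union_disjoint[symmetric])
        (auto intro!: sum.cong intro: order.strict_trans2[OF _ N(1)])
    also have "norm \<dots> \<le> (\<Sum>n\<in>{N div m * m..<N}. norm (\<chi> n))"
      using periods by (simp add: norm_sum)
    also have "\<dots> \<le> (\<Sum>n\<in>{N div m * m..<N}. 1)"
      by (intro sum_mono norm_dchars_le[OF assms(1,3)])
    also have "\<dots> = real (N - N div m * m)"
      by simp
    also have "\<dots> \<le> m"
      using N by linarith
    finally show ?thesis .
  qed
  show ?thesis
  proof (cases "a \<le> b")
    case True
    have "(\<Sum>n<b. \<chi> n) = (\<Sum>n<a. \<chi> n) + (\<Sum>n\<in>{a..<b}. \<chi> n)"
      using True by (subst sum.union_disjoint[symmetric]) (auto intro!: sum.cong)
    hence "(\<Sum>n\<in>{a..<b}. \<chi> n) = (\<Sum>n<b. \<chi> n) - (\<Sum>n<a. \<chi> n)"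
      by simp
    thus ?thesis
      using norm_triangle_ineq4[of "\<Sum>n<b. \<chi> n" "\<Sum>n<a. \<chi> n"] initial[of a] initial[of b] by simp
  qed simp
qed

text \<open>
  Characters that separate residue classes are found by linear algebra: the translations
  \<open>f \<mapsto> (\<lambda>x. f (g * x))\<close> commute and have finite order, so they have common eigenfunctions, and
  these are characters up to a scalar. The sums below are, up to the factor \<open>N\<close>, the values at \<open>0\<close>
  of the projections of \<open>c\<close> onto the eigenspaces of the cyclic shift of order \<open>N\<close>. The projections
  add up to \<open>c\<close>, so these values are not all zero if \<open>c 0 \<noteq> 0\<close>.
\<close>

lemma root_unity_projection_nonzero:
  fixes c :: "nat \<Rightarrow> complex"
  assumes "N > 0" "c 0 \<noteq> 0"
  shows "\<exists>z. z ^ N = 1 \<and> (\<Sum>i<N. z ^ i * c i) \<noteq> 0"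
proof (rule ccontr)
  assume *: "\<not> ?thesis"
  \<comment> \<open>A primitive root of unity; summing all the projections at \<open>0\<close> isolates \<open>c 0\<close>.\<close>
  define w where "w = cis (2 * pi / N)"
  have wj: "w ^ j = cis (2 * pi * real j / N)" for j
    by (simp add: w_def DeMoivre mult_ac)
  have wN: "(w ^ j) ^ N = 1" for j
    using assms(1) using cis_multiple_2pi[of "real j"] by (simp add: wj DeMoivre mult_ac)
  have winj: "w ^ j \<noteq> 1" if "0 < j" "j < N" for j
  proof
    assume "w ^ j = 1"
    hence "w ^ j = w ^ 0" by simp
    moreover have "inj_on (\<lambda>k. cis (2 * pi * real k / real N)) {..<N}"
      using bij_betw_roots_unity[OF assms(1)] by (simp add: bij_betw_def)
    ultimately show False
      using that unfolding wj by (auto dest: inj_onD[where x = j and y = 0])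
  qed
  have "0 = (\<Sum>j<N. \<Sum>i<N. (w ^ j) ^ i * c i)"
    using * wN by simp
  also have "\<dots> = (\<Sum>i<N. (\<Sum>j<N. (w ^ i) ^ j) * c i)"
    by (subst sum.swap) (simp add: sum_distrib_right flip: power_mult, simp add: mult.commute)
  also have "\<dots> = (\<Sum>i<N. if i = 0 then of_nat N * c 0 else 0)"
  proof (intro sum.cong refl)
    fix i assume i: "i \<in> {..<N}"
    show "(\<Sum>j<N. (w ^ i) ^ j) * c i = (if i = 0 then of_nat N * c 0 else 0)"
    proof (cases "i = 0")
      case False
      thus ?thesis using winj[of i] i wN[of i] by (simp add: geometric_sum)
    qed simp
  qed
  also have "\<dots> = of_nat N * c 0"
    using assms(1) by simp
  finally show False using assms by simp
qed

text \<open>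
  The nonzero functions on the group of residues prime to \<open>m\<close>, extended by zero and regarded as
  periodic functions on the natural numbers.
\<close>

definition class_fun :: "nat \<Rightarrow> (nat \<Rightarrow> complex) \<Rightarrow> bool" where
  "class_fun m f \<longleftrightarrow> (\<forall>x. f (x mod m) = f x) \<and> (\<forall>x. \<not> coprime x m \<longrightarrow> f x = 0) \<and> (\<exists>x. f x \<noteq> 0)"

text \<open>
  Up to the factor \<open>\<phi>(m)\<close>, \<open>F\<close> is the projection of \<open>f\<close> onto the eigenspace of translation by \<open>g\<close>
  with eigenvalue \<open>1/z\<close>.
  The order of the translation divides \<open>\<phi>(m)\<close> by Euler's theorem. The formula for \<open>F\<close> is exported
  because it shows that \<open>F\<close> inherits the eigenvalues of \<open>f\<close> for the other translations.
\<close>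

lemma eigenfunction_step:
  assumes m: "m > 0" and f: "class_fun m f" and g: "coprime g m"
  obtains z F where "z ^ totient m = 1" "class_fun m F" "\<And>x. z * F (g * x) = F x"
    "\<And>x. F x = (\<Sum>i<totient m. z ^ i * f (g ^ i * x))"
proof -
  define N where "N = totient m"
  have N: "N > 0" using m by (simp add: N_def)
  have fmod: "f a = f b" if "[a = b] (mod m)" for a b
    using f that unfolding class_fun_def cong_def by metis
  obtain x0 where x0: "f x0 \<noteq> 0" using f by (auto simp: class_fun_def)
  obtain z where z: "z ^ N = 1" "(\<Sum>i<N. z ^ i * f (g ^ i * x0)) \<noteq> 0"
    using root_unity_projection_nonzero[OF N, of "\<lambda>i. f (g ^ i * x0)"] x0 by auto
  define F where "F = (\<lambda>x. \<Sum>i<N. z ^ i * f (g ^ i * x))"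
  have "class_fun m F"
    unfolding class_fun_def
  proof (intro conjI allI impI)
    show "F (x mod m) = F x" for x
      unfolding F_def by (intro sum.cong refl arg_cong2[of _ _ _ _ "(*)"] fmod)
        (simp_all add: cong_def mod_mult_right_eq)
    show "F x = 0" if "\<not> coprime x m" for x
      unfolding F_def using f that by (intro sum.neutral) (auto simp: class_fun_def)
    show "\<exists>x. F x \<noteq> 0" using z(2) F_def by blast
  qed
  moreover have "z * F (g * x) = F x" for x
  proof -
    have "z * F (g * x) = (\<Sum>i<N. z ^ Suc i * f (g ^ Suc i * x))"
      unfolding F_def sum_distrib_left by (intro sum.cong) (simp_all add: mult_ac)
    also have "\<dots> = (\<Sum>i<N. z ^ i * f (g ^ i * x)) + (z ^ N * f (g ^ N * x) - f x)"
      using sum.lessThan_Suc_shift[of "\<lambda>i. z ^ i * f (g ^ i * x)" N] by (simp add: algebra_simps)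
    also have "f (g ^ N * x) = f x"
      using cong_mult[OF euler_theorem[OF g] cong_refl[of x]] by (intro fmod) (simp add: N_def)
    finally show ?thesis using z by (simp add: F_def)
  qed
  ultimately show thesis
    using that[of z F] z(1) by (simp add: F_def N_def)
qed

text \<open>
  The last conjunct, that eigenvalues of \<open>f\<close> are kept, is what makes it possible to prescribe one
  eigenvalue in advance and thus to separate a given residue from 1.
\<close>

lemma common_eigenfunction:
  assumes "m > 0" "class_fun m f" "finite S" "\<forall>g\<in>S. coprime g m"
  shows "\<exists>F. class_fun m F \<and> (\<forall>g\<in>S. \<exists>c. \<forall>x. F (g * x) = c * F x) \<and>
             (\<forall>h c. (\<forall>x. f (h * x) = c * f x) \<longrightarrow> (\<forall>x. F (h * x) = c * F x))"
  using assms(3,4)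
proof (induction rule: finite_induct)
  case empty
  thus ?case using assms by auto
next
  case (insert g S)
  then obtain F where F: "class_fun m F" "\<And>g. g \<in> S \<Longrightarrow> \<exists>c. \<forall>x. F (g * x) = c * F x"
    "\<And>h c x. (\<forall>x. f (h * x) = c * f x) \<Longrightarrow> F (h * x) = c * F x" by auto
  obtain z G where G: "z ^ totient m = 1" "class_fun m G" "\<And>x. z * G (g * x) = G x"
    "\<And>x. G x = (\<Sum>i<totient m. z ^ i * F (g ^ i * x))"
    using eigenfunction_step[OF assms(1) F(1), of g] insert.prems by auto
  have z: "z \<noteq> 0" using G(1) assms(1) by (auto simp: power_0_left)
  \<comment> \<open>Translations commute, so averaging keeps every earlier eigenvalue.\<close>
  have keep: "G (h * x) = c * G x" if "\<forall>x. F (h * x) = c * F x" for h c x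
  proof -
    have "G (h * x) = (\<Sum>i<totient m. z ^ i * F (h * (g ^ i * x)))"
      by (simp add: G(4) mult_ac)
    also have "\<dots> = (\<Sum>i<totient m. c * (z ^ i * F (g ^ i * x)))"
      unfolding that[rule_format] by (simp add: mult_ac)
    finally show ?thesis by (simp add: G(4) sum_distrib_left)
  qed
  have "G (g * x) = (1 / z) * G x" for x
    using G(3)[of x] z by (simp add: field_simps)
  hence "\<forall>h\<in>insert g S. \<exists>c. \<forall>x. G (h * x) = c * G x"
    using keep F(2) by blast
  moreover have "\<forall>h c. (\<forall>x. f (h * x) = c * f x) \<longrightarrow> (\<forall>x. G (h * x) = c * G x)"
    using keep F(3) by blast
  ultimately show ?case using G(2) by blast
qed

lemma character_of_eigenfunction:
  assumes m: "m > 0" and F: "class_fun m F"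
    and eig: "\<And>g. g < m \<Longrightarrow> coprime g m \<Longrightarrow> \<exists>c. \<forall>x. F (g * x) = c * F x"
  shows "F 1 \<noteq> 0" "(\<lambda>x. F x / F 1) \<in> dchars m"
proof -
  have Fmod: "F a = F b" if "[a = b] (mod m)" for a b
    using F that unfolding class_fun_def cong_def by metis
  have eig': "\<exists>c. \<forall>x. F (g * x) = c * F x" if "coprime g m" for g
  proof -
    have "coprime (g mod m) m" using that m by simp
    then obtain c where "\<And>x. F ((g mod m) * x) = c * F x"
      using eig[of "g mod m"] m by auto
    moreover have "F ((g mod m) * x) = F (g * x)" for x
      by (intro Fmod) (simp add: cong_def mod_mult_left_eq)
    ultimately show ?thesis by metis
  qed
  obtain x1 where x1: "F x1 \<noteq> 0" using F by (auto simp: class_fun_def)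
  hence "coprime x1 m" using F by (auto simp: class_fun_def)
  then obtain c where "F (x1 * 1) = c * F 1" using eig' by blast
  thus F1: "F 1 \<noteq> 0" using x1 by auto
  have mult: "F (g * x) / F 1 = F g / F 1 * (F x / F 1)" for g x
  proof (cases "coprime g m")
    case True
    then obtain c where c: "\<And>x. F (g * x) = c * F x" using eig' by blast
    show ?thesis using c[of 1] c[of x] F1 by simp
  next
    case False
    thus ?thesis using F by (simp add: class_fun_def)
  qed
  have "F x \<noteq> 0" if x: "coprime x m" for x
  proof -
    obtain y where "[x * y = 1] (mod m)" using cong_solve_coprime_nat[OF x] by auto
    hence "F (x * y) = F 1" by (rule Fmod)
    thus ?thesis using mult[of x y] F1 by auto
  qed
  thus "(\<lambda>x. F x / F 1) \<in> dchars m"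
    unfolding dchars_def using mult F F1 by (auto simp: class_fun_def)
qed

text \<open>
  Let \<open>\<delta>\<close> be the indicator function of the class of 1. The function \<open>x \<mapsto> \<delta> x - \<delta> (a * x)\<close> is
  nonzero, but its projection to the invariants of translation by \<open>a\<close> is zero. So it has a nonzero
  projection to an eigenspace with eigenvalue other than 1, and any common eigenfunction obtained
  from there gives a character that is not 1 at \<open>a\<close>.
\<close>

lemma separating_character:
  assumes m: "m > 0" and a: "coprime a m" "\<not> [a = 1] (mod m)"
  obtains \<chi> where "\<chi> \<in> dchars m" "\<chi> a \<noteq> 1"
proof -
  define \<delta> where "\<delta> = (\<lambda>x. if [x = 1] (mod m) then 1 else 0 :: complex)"
  define f where "f = (\<lambda>x. \<delta> x - \<delta> (a * x))"
  have f: "class_fun m f"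
    unfolding class_fun_def
  proof (intro conjI allI impI)
    show "f (x mod m) = f x" for x
      unfolding f_def \<delta>_def cong_def by (simp only: mod_mod_trivial mod_mult_right_eq)
    show "f x = 0" if "\<not> coprime x m" for x
    proof -
      have "\<not> [b * x = 1] (mod m)" for b
        using that cong_imp_coprime[OF cong_sym, of "b * x" 1 m] by auto
      hence "\<delta> (b * x) = 0" for b
        by (simp add: \<delta>_def)
      from this[of 1] this[of a] show ?thesis by (simp add: f_def)
    qed
    have "f 1 = 1" using a by (simp add: f_def \<delta>_def)
    thus "\<exists>x. f x \<noteq> 0" by (metis zero_neq_one)
  qed
  obtain z F where F: "z ^ totient m = 1" "class_fun m F" "\<And>x. z * F (a * x) = F x"
    "\<And>x. F x = (\<Sum>i<totient m. z ^ i * f (a ^ i * x))"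
    using eigenfunction_step[OF m f a(1)] by auto
  \<comment> \<open>For eigenvalue 1 the average of \<open>f\<close> telescopes to zero.\<close>
  have "z \<noteq> 1"
  proof
    assume "z = 1"
    have "F x = 0" for x
    proof -
      have "F x = (\<Sum>i<totient m. \<delta> (a ^ i * x) - \<delta> (a ^ Suc i * x))"
        using F(4) \<open>z = 1\<close> by (simp add: f_def mult_ac)
      also have "\<dots> = \<delta> (a ^ 0 * x) - \<delta> (a ^ totient m * x)"
        by (rule sum_lessThan_telescope')
      also have "[a ^ totient m * x = 1 * x] (mod m)"
        by (intro cong_mult euler_theorem a cong_refl)
      hence "\<delta> (a ^ totient m * x) = \<delta> x"
        by (simp add: \<delta>_def cong_def)
      finally show ?thesis by simp
    qed
    thus False using F(2) by (simp add: class_fun_def)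
  qed
  have z0: "z \<noteq> 0" using F(1) m by (auto simp: power_0_left)
  have Fa: "\<forall>x. F (a * x) = (1 / z) * F x"
    using F(3) z0 by (simp add: field_simps)
  have "finite {g. g < m \<and> coprime g m}" "\<forall>g\<in>{g. g < m \<and> coprime g m}. coprime g m"
    by simp_all
  from common_eigenfunction[OF m F(2) this] obtain G where G: "class_fun m G"
    "\<forall>g\<in>{g. g < m \<and> coprime g m}. \<exists>c. \<forall>x. G (g * x) = c * G x"
    "\<forall>h c. (\<forall>x. F (h * x) = c * F x) \<longrightarrow> (\<forall>x. G (h * x) = c * G x)"
    by (elim exE conjE)
  have eig: "\<exists>c. \<forall>x. G (g * x) = c * G x" if "g < m" "coprime g m" for g
    using G(2) that by simp
  have "G (a * 1) = (1 / z) * G 1"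
    using G(3) Fa by blast
  hence "G a / G 1 = 1 / z"
    using character_of_eigenfunction(1)[OF m G(1) eig] by simp
  hence "G a / G 1 \<noteq> 1" using \<open>z \<noteq> 1\<close> by auto
  thus thesis using character_of_eigenfunction(2)[OF m G(1) eig] that by blast
qed

text \<open>
  If \<open>\<psi> a \<noteq> 1\<close>, then multiplication by \<open>\<psi>\<close> permutes the characters, so the sum is equal to
  \<open>\<psi> a\<close> times itself.
\<close>

lemma dchars_orthogonality:
  assumes m: "m > 0" and a: "coprime a m"
  shows "(\<Sum>\<chi>\<in>dchars m. \<chi> a) = (if [a = 1] (mod m) then of_nat (card (dchars m)) else 0)"
proof (cases "[a = 1] (mod m)")
  case True
  hence "\<chi> a = 1" if "\<chi> \<in> dchars m" for \<chi>
    using dchars_cong[OF that True] dchars_1[OF that] by simp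
  hence "(\<Sum>\<chi>\<in>dchars m. \<chi> a) = (\<Sum>\<chi>\<in>dchars m. 1)"
    by (intro sum.cong) auto
  thus ?thesis using True by simp
next
  case False
  then obtain \<psi> where \<psi>: "\<psi> \<in> dchars m" "\<psi> a \<noteq> 1"
    using separating_character[OF m a] by blast
  have "(\<Sum>\<chi>\<in>dchars m. \<chi> a) = (\<Sum>\<chi>\<in>dchars m. \<psi> a * \<chi> a)"
  proof (rule sum.reindex_bij_witness)
    fix \<chi> assume \<chi>: "\<chi> \<in> dchars m"
    show "(\<lambda>x. \<chi> x / \<psi> x) \<in> dchars m" "(\<lambda>x. \<psi> x * \<chi> x) \<in> dchars m"
      using \<chi> \<psi> by (simp_all add: dchars_divide dchars_times)
    show "(\<lambda>x. \<psi> x * (\<chi> x / \<psi> x)) = \<chi>" "(\<lambda>x. \<psi> x * \<chi> x / \<psi> x) = \<chi>"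
      using \<chi> \<psi>(1) by (auto simp: dchars_def fun_eq_iff)
    show "\<psi> a * (\<chi> a / \<psi> a) = \<chi> a"
      using \<psi> a dchars_eq_0_iff by auto
  qed
  also have "\<dots> = \<psi> a * (\<Sum>\<chi>\<in>dchars m. \<chi> a)"
    by (simp add: sum_distrib_left)
  finally show ?thesis using \<psi>(2) False by simp
qed

section \<open>Divisor sums and partial summation\<close>

text \<open>
  Both sides run over the pairs \<open>(d, k)\<close> with \<open>d * k \<le> N\<close>.
\<close>

lemma sum_divisors_swap:
  fixes F :: "nat \<Rightarrow> nat \<Rightarrow> 'a :: comm_monoid_add"
  shows "(\<Sum>n=1..N. \<Sum>d | d dvd n. F d (n div d)) = (\<Sum>d=1..N. \<Sum>k=1..N div d. F d k)"
proof -
  have "(\<Sum>n=1..N. \<Sum>d | d dvd n. F d (n div d)) =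
        (\<Sum>(n,d)\<in>(SIGMA n:{1..N}. {d. d dvd n}). F d (n div d))"
    by (subst sum.Sigma) auto
  also have "\<dots> = (\<Sum>(d,k)\<in>(SIGMA d:{1..N}. {1..N div d}). F d k)"
  proof (rule sum.reindex_bij_witness[of _ "\<lambda>(d,k). (d * k, d)" "\<lambda>(n,d). (d, n div d)"])
    fix x assume "x \<in> (SIGMA n:{1..N}. {d. d dvd n})"
    then obtain d k where x: "x = (d * k, d)" "1 \<le> d * k" "d * k \<le> N"
      by (auto elim!: dvdE)
    have "d > 0" "k > 0" using x by (auto intro!: Nat.gr0I)
    moreover have "d \<le> N" using x(3) mult_le_mono2[of 1 k d] \<open>k > 0\<close> by linarith
    moreover have "k \<le> N div d" using x \<open>d > 0\<close> by (simp add: less_eq_div_iff_mult_less_eq mult.commute)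
    ultimately show "(\<lambda>(d,k). (d * k, d)) ((\<lambda>(n,d). (d, n div d)) x) = x"
      "(\<lambda>(n,d). (d, n div d)) x \<in> (SIGMA d:{1..N}. {1..N div d})"
      "(case (\<lambda>(n,d). (d, n div d)) x of (d,k) \<Rightarrow> F d k) = (case x of (n,d) \<Rightarrow> F d (n div d))"
      using x by auto
  next
    fix x assume "x \<in> (SIGMA d:{1..N}. {1..N div d})"
    then obtain d k where x: "x = (d, k)" "1 \<le> d" "1 \<le> k" "k \<le> N div d"
      by auto
    hence "d * k \<le> N" by (simp add: less_eq_div_iff_mult_less_eq mult.commute)
    moreover have "d * k \<ge> 1" using x by (simp add: Suc_leI)
    ultimately show "(\<lambda>(n,d). (d, n div d)) ((\<lambda>(d,k). (d * k, d)) x) = x"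
      "(\<lambda>(d,k). (d * k, d)) x \<in> (SIGMA n:{1..N}. {d. d dvd n})"
      using x by auto
  qed
  also have "\<dots> = (\<Sum>d=1..N. \<Sum>k=1..N div d. F d k)"
    by (subst sum.Sigma) auto
  finally show ?thesis .
qed

text \<open>
  Summation by parts with the partial sums of \<open>f\<close>: the differences of \<open>g\<close> telescope to \<open>g a\<close>.
\<close>

lemma abel_summation_bound:
  fixes f :: "nat \<Rightarrow> 'a :: real_normed_vector" and g :: "nat \<Rightarrow> real"
  assumes bound: "\<And>b. norm (\<Sum>n\<in>{a..<b}. f n) \<le> B"
    and mono: "\<And>n. n \<ge> a \<Longrightarrow> g (Suc n) \<le> g n" and nonneg: "\<And>n. n \<ge> a \<Longrightarrow> g n \<ge> 0"
  shows "norm (\<Sum>n\<in>{a..<b}. g n *\<^sub>R f n) \<le> g a * B"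
proof (cases "a \<le> b")
  case True
  define F where "F = (\<lambda>b. \<Sum>n\<in>{a..<b}. f n)"
  \<comment> \<open>\<open>F (Suc n)\<close> is the sum of \<open>f\<close> up to and including \<open>n\<close>.\<close>
  have by_parts: "(\<Sum>n\<in>{a..<b}. g n *\<^sub>R f n) =
      (\<Sum>n\<in>{a..<b}. (g n - g (Suc n)) *\<^sub>R F (Suc n)) + g b *\<^sub>R F b"
    using True by (induction rule: dec_induct) (simp_all add: F_def algebra_simps)
  have decreasing: "(\<Sum>n\<in>{a..<b}. g n - g (Suc n)) = g a - g b"
    using sum_Suc_diff'[OF True, of "\<lambda>n. - g n"] by simp
  have "norm (\<Sum>n\<in>{a..<b}. g n *\<^sub>R f n) \<le>
      (\<Sum>n\<in>{a..<b}. norm ((g n - g (Suc n)) *\<^sub>R F (Suc n))) + norm (g b *\<^sub>R F b)"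
    unfolding by_parts by (intro order.trans[OF norm_triangle_ineq] add_right_mono norm_sum)
  also have "\<dots> \<le> (\<Sum>n\<in>{a..<b}. (g n - g (Suc n)) * B) + g b * B"
    using mono nonneg True bound
    by (intro add_mono sum_mono) (auto simp: F_def intro!: mult_left_mono simp del: sum.op_ivl_Suc)
  also have "\<dots> = g a * B"
    unfolding sum_distrib_right[symmetric] decreasing by (simp add: algebra_simps)
  finally show ?thesis .
next
  case False
  thus ?thesis using bound[of a] nonneg[of a] by simp
qed

lemma real_div_less:
  assumes "d > 0"
  shows "real N / d < real (N div d) + 1"
proof -
  have "N < (N div d + 1) * d"
    using div_mult_mod_eq[of N d] mod_less_divisor[OF assms, of N]
    unfolding add_mult_distrib by linarith
  hence "real N < (real (N div d) + 1) * d"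
    by (metis of_nat_1 of_nat_add of_nat_less_iff of_nat_mult)
  thus ?thesis using assms by (simp add: divide_less_eq)
qed

section \<open>Chebyshev and Mertens estimates\<close>

lemma ln_fact_eq_sum_ln: "ln (fact N :: real) = (\<Sum>n=1..N. ln (real n))"
  by (induction N) (simp_all add: fact_Suc ln_mult del: of_nat_Suc)

text \<open>
  The source of all information on the size of sums of \<open>\<Lambda>\<close>: the left-hand side is known
  precisely by the elementary form of Stirling's formula.
\<close>

lemma ln_fact_eq_mangoldt_sum:
  "ln (fact N :: real) = (\<Sum>d=1..N. mangoldt d * real (N div d))"
proof -
  have "ln (fact N :: real) = (\<Sum>n=1..N. ln (real n))"
    by (rule ln_fact_eq_sum_ln)
  also have "\<dots> = (\<Sum>n=1..N. \<Sum>d | d dvd n. mangoldt d)"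
    by (intro sum.cong refl, subst mangoldt_sum) auto
  also have "\<dots> = (\<Sum>d=1..N. \<Sum>k=1..N div d. mangoldt d)"
    by (rule sum_divisors_swap)
  finally show ?thesis by (simp add: mult.commute)
qed

lemma ln_fact_ge: "real N * ln N - N \<le> ln (fact N)"
proof (induction N)
  case (Suc N)
  show ?case
  proof (cases "N = 0")
    case False
    have "ln (real (Suc N)) - ln N \<le> 1 / N"
      using False ln_le_minus_one[of "real (Suc N) / N"] by (simp add: ln_div field_simps)
    hence "N * ln (real (Suc N)) \<le> N * ln N + 1"
      using False by (simp add: field_simps)
    hence "Suc N * ln (real (Suc N)) - Suc N \<le> ln (fact N) + ln (Suc N)"
      using Suc by (simp add: algebra_simps)
    also have "\<dots> = ln (fact (Suc N))"
      by (simp add: ln_mult add.commute)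
    finally show ?thesis .
  qed simp
qed simp

lemma ln_fact_le: "ln (fact N :: real) \<le> N * ln N"
proof (cases "N = 0")
  case False
  have "ln (fact N :: real) \<le> ln (real N ^ N)"
    using False fact_le_power[of N, where 'a = real] by (intro ln_mono) auto
  thus ?thesis using False by (simp add: ln_realpow)
qed simp

text \<open>
  Chebyshev's function.
\<close>

definition psi :: "nat \<Rightarrow> real" where "psi N = (\<Sum>d=1..N. mangoldt d)"

text \<open>
  Put \<open>h = N div 2\<close>. In \<open>ln (N!) - 2 ln (h!) = \<Sum>\<Lambda>(d) (N div d - 2 (h div d))\<close> the bracket is
  the parity of \<open>N div d\<close>, hence nonnegative, and it is 1 for \<open>h < d \<le> N\<close>. On the other hand
  \<open>N!/(h!)\<^sup>2\<close> is at most \<open>h + 1\<close> times a binomial coefficient, hence at most \<open>(h + 1) 2\<^sup>N\<close>.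
\<close>

lemma psi_half_step: "psi N - psi (N div 2) \<le> 2 * N"
proof -
  define h where "h = N div 2"
  have h: "h \<le> N" by (simp add: h_def)
  have "psi N - psi h = (\<Sum>d\<in>{h<..N}. mangoldt d)"
    unfolding psi_def using h by (subst sum_diff[symmetric]) (auto intro!: sum.cong)
  also have "\<dots> \<le> (\<Sum>d=1..N. mangoldt d * (real (N div d) - 2 * real (h div d)))"
  proof -
    have "real (N div d) - 2 * real (h div d) = real ((N div d) mod 2)" for d
    proof -
      have "h div d = N div d div 2" by (simp add: h_def div_mult2_eq[symmetric] mult.commute)
      thus ?thesis using div_mult_mod_eq[of "N div d" 2]
        by (metis add_diff_cancel_left' mult.commute of_nat_add of_nat_mult of_nat_numeral)
    qed
    hence "(\<Sum>d=1..N. mangoldt d * (real (N div d) - 2 * real (h div d))) =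
           (\<Sum>d=1..N. mangoldt d * real ((N div d) mod 2))" by simp
    also have "\<dots> \<ge> (\<Sum>d\<in>{h<..N}. mangoldt d * real ((N div d) mod 2))"
      by (intro sum_mono2) (auto simp: mangoldt_nonneg)
    also have "(\<Sum>d\<in>{h<..N}. mangoldt d * real ((N div d) mod 2)) = (\<Sum>d\<in>{h<..N}. mangoldt d)"
    proof (intro sum.cong refl)
      fix d assume d: "d \<in> {h<..N}"
      hence "N div d < 2" by (subst div_less_iff_less_mult) (auto simp: h_def)
      moreover have "N div d \<noteq> 0" using d by (auto simp: div_eq_0_iff)
      ultimately have "N div d = 1" by simp
      thus "mangoldt d * real ((N div d) mod 2) = mangoldt d" by simp
    qed
    finally show ?thesis by simp
  qed
  also have "\<dots> = ln (fact N) - 2 * (\<Sum>d=1..N. mangoldt d * real (h div d))"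
    by (simp add: ln_fact_eq_mangoldt_sum right_diff_distrib sum_subtractf sum_distrib_left mult_ac)
  also have "(\<Sum>d=1..N. mangoldt d * real (h div d)) = (\<Sum>d=1..h. mangoldt d * real (h div d))"
    using h by (intro sum.mono_neutral_right) auto
  also have "\<dots> = ln (fact h)"
    by (rule ln_fact_eq_mangoldt_sum[symmetric])
  also have "ln (fact N :: real) - 2 * ln (fact h) \<le> 2 * N"
  proof -
    have "fact N = fact h * fact (N - h) * (N choose h)"
      using binomial_fact_lemma[OF h] by (simp add: mult_ac)
    also have "\<dots> \<le> fact h * (fact h * Suc h) * 2 ^ N"
    proof (intro mult_mono)
      have "N - h \<le> Suc h" by (simp add: h_def)
      hence "fact (N - h) \<le> (fact (Suc h) :: nat)" by (rule fact_mono)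
      thus "fact (N - h) \<le> fact h * Suc h" by (simp add: mult.commute)
      show "N choose h \<le> 2 ^ N" by (rule binomial_le_pow2)
    qed auto
    finally have "real (fact N) \<le> real (fact h * (fact h * Suc h) * 2 ^ N)"
      by (rule of_nat_mono)
    hence "ln (real (fact N)) \<le> ln (real (fact h * (fact h * Suc h) * 2 ^ N))"
      by (intro ln_mono) (auto simp del: of_nat_fact)
    also have "real (fact h * (fact h * Suc h) * 2 ^ N) = fact h * (fact h * real (Suc h)) * 2 ^ N"
      by (simp only: of_nat_mult of_nat_fact of_nat_power of_nat_numeral)
    also have "ln \<dots> = 2 * ln (fact h) + ln (real (Suc h)) + N * ln 2"
      by (simp add: ln_mult ln_realpow del: of_nat_Suc)
    also have "ln (real (Suc h)) \<le> h"
      using ln_add_one_self_le_self[of "real h"] by (simp add: add.commute)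
    also have "N * ln 2 \<le> N * (1::real)"
      using ln_le_minus_one[of 2] by (intro mult_left_mono) auto
    finally show ?thesis using h by simp
  qed
  finally show ?thesis by (simp add: h_def)
qed

lemma psi_le: "psi N \<le> 4 * N"
proof (induction N rule: less_induct)
  case (less N)
  show ?case
  proof (cases "N = 0")
    case False
    hence "psi (N div 2) \<le> 4 * real (N div 2)" using less by simp
    moreover have "2 * real (N div 2) \<le> N"
      by (metis of_nat_le_iff of_nat_mult of_nat_numeral times_div_less_eq_dividend)
    ultimately show ?thesis using psi_half_step[of N] by linarith
  qed (simp add: psi_def)
qed

text \<open>
  Replacing \<open>N div d\<close> by \<open>N / d\<close> in \<open>ln_fact_eq_mangoldt_sum\<close> only increases the sum; in the
  other direction the total error is at most \<open>psi N\<close>, which is \<open>O(N)\<close>.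
\<close>

lemma mertens_lower: "N > 0 \<Longrightarrow> (\<Sum>n=1..N. mangoldt n / n) \<ge> ln N - 1"
proof -
  assume N: "N > 0"
  have "N * (ln N - 1) \<le> ln (fact N)"
    using ln_fact_ge[of N] by (simp add: algebra_simps)
  also have "\<dots> \<le> (\<Sum>d=1..N. mangoldt d * (N / d))"
    unfolding ln_fact_eq_mangoldt_sum
    by (intro sum_mono mult_left_mono of_nat_div_le_of_nat mangoldt_nonneg)
  also have "\<dots> = N * (\<Sum>n=1..N. mangoldt n / n)"
    by (simp add: sum_distrib_left mult_ac)
  finally show ?thesis using N by simp
qed

lemma mertens_upper: "N > 0 \<Longrightarrow> (\<Sum>n=1..N. mangoldt n / n) \<le> ln N + 4"
proof -
  assume N: "N > 0"
  have "N * (\<Sum>n=1..N. mangoldt n / n) = (\<Sum>d=1..N. mangoldt d * (N / d))"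
    by (simp add: sum_distrib_left mult_ac)
  also have "\<dots> \<le> (\<Sum>d=1..N. mangoldt d * (real (N div d) + 1))"
  proof (intro sum_mono mult_left_mono mangoldt_nonneg)
    fix d assume "d \<in> {1..N}"
    thus "N / d \<le> real (N div d) + 1"
      using real_div_less[of d N] by simp
  qed
  also have "\<dots> = ln (fact N) + psi N"
    by (simp add: ln_fact_eq_mangoldt_sum psi_def distrib_left sum.distrib)
  also have "\<dots> \<le> N * ln N + 4 * N"
    using ln_fact_le psi_le by (intro add_mono)
  also have "\<dots> = N * (ln N + 4)"
    by (simp add: algebra_simps)
  finally show ?thesis using N by simp
qed

section \<open>The Moebius function\<close>

definition moebius :: "nat \<Rightarrow> real" where
  "moebius n = (if squarefree n then (- 1) ^ card (prime_factors n) else 0)"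

lemma abs_moebius_le: "\<bar>moebius n\<bar> \<le> 1"
  by (simp add: moebius_def power_abs)

lemma moebius_1 [simp]: "moebius (Suc 0) = 1"
  by (simp add: moebius_def flip: One_nat_def)

lemma moebius_prime_mult:
  assumes "prime p" "\<not> p dvd n"
  shows "moebius (p * n) = - moebius n"
proof -
  have cop: "coprime p n" using assms prime_imp_coprime by blast
  have n: "n \<noteq> 0" using assms(2) by (metis dvd_0_right)
  have "prime_factors (p * n) = insert p (prime_factors n)"
    using assms n by (simp add: prime_factors_product prime_prime_factors)
  moreover have "p \<notin> prime_factors n" using assms by auto
  moreover have "squarefree (p * n) \<longleftrightarrow> squarefree n"
    using assms cop squarefree_multD(2)[of p n] squarefree_mult_coprime[OF cop] squarefree_prime by blast
  ultimately show ?thesis by (simp add: moebius_def)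
qed

text \<open>
  A squarefree divisor of \<open>p\<^sup>k * n\<close> is either a divisor \<open>d\<close> of \<open>n\<close> or \<open>p * d\<close> for such a \<open>d\<close>, and
  \<open>moebius\<close> has opposite signs on the two. Taking \<open>F\<close> to be constant and \<open>F = ln\<close> gives the two
  evaluations that follow.
\<close>

lemma sum_moebius_split:
  fixes F :: "nat \<Rightarrow> real"
  assumes p: "prime p" and n: "\<not> p dvd n" and k: "k > 0"
  shows "(\<Sum>d | d dvd p ^ k * n. moebius d * F d) = (\<Sum>d | d dvd n. moebius d * (F d - F (p * d)))"
proof -
  have n0: "n \<noteq> 0" using n by (metis dvd_0_right)
  let ?A = "{d. d dvd n}"
  have fin: "finite {d. d dvd p ^ k * n}" "finite ?A"
    using p n0 by (auto intro!: finite_divisors_nat simp: prime_gt_0_nat)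
  have zero: "moebius d = 0" if d: "d dvd p ^ k * n" "d \<notin> ?A \<union> (*) p ` ?A" for d
  proof (rule ccontr)
    assume "moebius d \<noteq> 0"
    hence sq: "squarefree d" by (auto simp: moebius_def split: if_splits)
    show False
    proof (cases "p dvd d")
      case False
      hence "coprime d (p ^ k)"
        using p prime_imp_coprime[of p d] by (simp add: coprime_commute)
      thus False using d by (auto simp: coprime_dvd_mult_right_iff)
    next
      case True
      then obtain e where e: "d = p * e" by blast
      hence "\<not> p dvd e" using sq squarefreeD[OF sq, of p] p
        by (auto simp: power2_eq_square)
      hence "coprime e (p ^ k)"
        using p prime_imp_coprime[of p e] by (simp add: coprime_commute)
      moreover have "e dvd p ^ k * n" using d(1) e by (meson dvd_mult_right)
      ultimately have "e dvd n" by (simp add: coprime_dvd_mult_right_iff)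
      thus False using d(2) e by blast
    qed
  qed
  have sub: "?A \<union> (*) p ` ?A \<subseteq> {d. d dvd p ^ k * n}"
    using k by (auto intro!: mult_dvd_mono simp: dvd_power)
  have "(\<Sum>d | d dvd p ^ k * n. moebius d * F d) = (\<Sum>d\<in>?A \<union> (*) p ` ?A. moebius d * F d)"
    using zero sub fin by (intro sum.mono_neutral_right) auto
  also have "\<dots> = (\<Sum>d\<in>?A. moebius d * F d) + (\<Sum>d\<in>(*) p ` ?A. moebius d * F d)"
    using fin n by (intro sum.union_disjoint) (auto dest: dvd_mult_left)
  also have "(\<Sum>d\<in>(*) p ` ?A. moebius d * F d) = (\<Sum>d\<in>?A. moebius (p * d) * F (p * d))"
    using p by (subst sum.reindex) (auto simp: inj_on_def)
  also have "\<dots> = (\<Sum>d\<in>?A. - (moebius d * F (p * d)))"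
  proof (intro sum.cong refl)
    fix d assume "d \<in> ?A"
    hence "\<not> p dvd d" using n dvd_trans by blast
    thus "moebius (p * d) * F (p * d) = - (moebius d * F (p * d))"
      using moebius_prime_mult[OF p] by simp
  qed
  finally show ?thesis
    by (simp add: sum_negf right_diff_distrib sum_subtractf)
qed

lemma prime_power_split:
  fixes n :: nat
  assumes "n > 1"
  obtains p k n' where "prime p" "k > 0" "\<not> p dvd n'" "n = p ^ k * n'" "n' > 0" "n' < n"
proof -
  obtain p where p: "prime p" "p dvd n" using assms prime_factor_nat[of n] by auto
  obtain n' where n': "n = p ^ multiplicity p n * n'" "\<not> p dvd n'"
    using multiplicity_decompose'[of n p] assms p by (metis not_one_less_zero not_prime_unit)
  have k: "multiplicity p n > 0"
    using assms p by (simp add: prime_multiplicity_gt_zero_iff)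
  have "n' > 0" using n'(2) by (metis dvd_0_right gr0I)
  moreover have "p ^ multiplicity p n > 1"
    using k prime_gt_1_nat[OF p(1)] by (rule one_less_power[rotated])
  hence "1 * n' < p ^ multiplicity p n * n'"
    using \<open>n' > 0\<close> by (intro mult_strict_right_mono)
  ultimately show thesis using that[OF p(1) k n'(2) n'(1)] n'(1) by simp
qed

lemma sum_moebius: "n > 0 \<Longrightarrow> (\<Sum>d | d dvd n. moebius d) = (if n = 1 then 1 else 0)"
proof (cases "n > 1")
  case True
  then obtain p k n' where "prime p" "k > 0" "\<not> p dvd n'" "n = p ^ k * n'"
    by (rule prime_power_split)
  hence "(\<Sum>d | d dvd n. moebius d) = 0"
    using sum_moebius_split[of p n' k "\<lambda>_. 1"] by simp
  thus ?thesis using True by simp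
next
  case False
  moreover assume "n > 0"
  ultimately have "n = 1" by simp
  thus ?thesis by simp
qed

text \<open>
  In the pairing of \<open>sum_moebius_split\<close> the differences \<open>ln d - ln (p * d)\<close> are all equal to
  \<open>- ln p\<close>. What remains is the sum of \<open>moebius\<close> over the divisors of the part of \<open>n\<close> prime to \<open>p\<close>,
  which is nonzero only if \<open>n\<close> is a power of \<open>p\<close>.
\<close>

lemma sum_moebius_ln: "n > 0 \<Longrightarrow> (\<Sum>d | d dvd n. moebius d * ln d) = - mangoldt n"
proof (cases "n > 1")
  case True
  then obtain p k n' where n: "prime p" "k > 0" "\<not> p dvd n'" "n = p ^ k * n'"
    by (rule prime_power_split)
  have n'0: "n' > 0" using n by (auto intro!: Nat.gr0I)
  have "(\<Sum>d | d dvd n. moebius d * ln d) = (\<Sum>d | d dvd n'. moebius d * (ln d - ln (p * d)))"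
    using n sum_moebius_split by simp
  also have "\<dots> = (\<Sum>d | d dvd n'. moebius d * - ln p)"
    using n'0 n by (intro sum.cong) (auto simp: ln_mult prime_gt_0_nat dest: dvd_pos_nat)
  also have "\<dots> = - ln p * (\<Sum>d | d dvd n'. moebius d)"
    by (simp add: sum_distrib_left mult_ac)
  also have "\<dots> = (if n' = 1 then - ln p else 0)"
    using n'0 by (simp add: sum_moebius)
  also have "\<dots> = - mangoldt n"
  proof (cases "n' = 1")
    case False
    have "\<not> primepow n"
    proof
      assume "primepow n"
      then obtain q j where q: "prime q" "n = q ^ j" by (auto simp: primepow_def)
      have "p dvd q ^ j" using n q by (metis dvd_mult2 dvd_power)
      hence "p = q" using n(1) q(1) by (metis prime_dvd_power primes_dvd_imp_eq)
      have "n' dvd p ^ j" using n q \<open>p = q\<close> by (metis dvd_triv_right)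
      moreover have "coprime n' (p ^ j)" using prime_imp_coprime[OF n(1,3)] by (simp add: coprime_commute)
      ultimately show False using False by (metis coprime_common_divisor_nat dvd_refl)
    qed
    thus ?thesis using False by (simp add: mangoldt_def)
  qed (use n in simp)
  finally show ?thesis .
next
  case False
  moreover assume "n > 0"
  ultimately have "n = 1" by simp
  thus ?thesis by simp
qed

section \<open>The value at 1 and the sums weighted by the Mangoldt function\<close>

text \<open>
  The properties of a nonprincipal character that the analytic part of the argument uses.
\<close>

locale oscillating =
  fixes f :: "nat \<Rightarrow> complex" and B :: real
  assumes mult: "f (a * b) = f a * f b" and one: "f 1 = 1" and norm_le: "norm (f a) \<le> 1"
    and bounded: "norm (\<Sum>n\<in>{a..<b}. f n) \<le> B"
begin

lemma B_nonneg: "B \<ge> 0"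
  using bounded[of 0 0] by simp

definition partial_L :: "nat \<Rightarrow> complex" where
  "partial_L N = (\<Sum>n=1..N. f n / of_nat n)"

text \<open>
  The value at \<open>s = 1\<close> of the Dirichlet series with coefficients \<open>f\<close>.
\<close>

definition L :: complex where "L = lim partial_L"

lemma partial_L_diff: "k \<le> N \<Longrightarrow> norm (partial_L N - partial_L k) \<le> B / (k + 1)"
proof -
  assume "k \<le> N"
  hence "{1..N} = {1..k} \<union> {Suc k..<Suc N}" by auto
  hence "partial_L N = partial_L k + (\<Sum>n\<in>{Suc k..<Suc N}. f n / of_nat n)"
    unfolding partial_L_def by (simp only:) (subst sum.union_disjoint; auto)
  also have "(\<Sum>n\<in>{Suc k..<Suc N}. f n / of_nat n) = (\<Sum>n\<in>{Suc k..<Suc N}. (1 / real n) *\<^sub>R f n)"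
    by (intro sum.cong) (auto simp: scaleR_conv_of_real)
  finally have "norm (partial_L N - partial_L k) =
      norm (\<Sum>n\<in>{Suc k..<Suc N}. (1 / real n) *\<^sub>R f n)"
    by (simp only: add_diff_cancel_left')
  also have "\<dots> \<le> 1 / real (Suc k) * B"
    by (intro abel_summation_bound bounded) (auto simp: field_simps)
  finally show ?thesis by (simp add: add.commute)
qed

lemma partial_L_tendsto: "partial_L \<longlonglongrightarrow> L"
proof -
  have "Cauchy partial_L"
  proof (rule metric_CauchyI)
    fix e :: real assume e: "e > 0"
    obtain M :: nat where M: "B / e < M" using reals_Archimedean2 by blast
    have close: "dist (partial_L i) (partial_L j) < e" if "M \<le> j" "j \<le> i" for i j
    proof -
      have "B < e * (j + 1)" using M e that
        by (simp add: field_simps) (smt (verit) mult_left_mono of_nat_le_iff)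
      hence "B / (j + 1) < e" by (simp add: field_simps)
      thus ?thesis using partial_L_diff[OF that(2)] by (simp add: dist_norm)
    qed
    show "\<exists>M. \<forall>i\<ge>M. \<forall>j\<ge>M. dist (partial_L i) (partial_L j) < e"
    proof (intro exI[of _ M] allI impI)
      fix i j assume "M \<le> i" "M \<le> j"
      thus "dist (partial_L i) (partial_L j) < e"
        using close[of j i] close[of i j] by (cases "j \<le> i") (auto simp: dist_commute)
    qed
  qed
  thus ?thesis using Cauchy_convergent_iff convergent_LIMSEQ_iff L_def by metis
qed

lemma partial_L_approx: "norm (partial_L k - L) \<le> B / (k + 1)"
proof -
  have "(\<lambda>N. norm (partial_L N - partial_L k)) \<longlonglongrightarrow> norm (L - partial_L k)"
    by (intro tendsto_norm tendsto_diff partial_L_tendsto tendsto_const)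
  moreover have "eventually (\<lambda>N. norm (partial_L N - partial_L k) \<le> B / (k + 1)) sequentially"
    using partial_L_diff eventually_sequentially by auto
  ultimately have "norm (L - partial_L k) \<le> B / (k + 1)"
    by (intro tendsto_upperbound[OF _ _ sequentially_bot])
  thus ?thesis by (simp add: norm_minus_commute)
qed

text \<open>
  Partial summation again; the quotient \<open>ln n / n\<close> decreases only from \<open>n = 3\<close> on, since \<open>e < 3\<close>,
  so the first two terms are split off.
\<close>

lemma sum_f_ln_bounded: "\<exists>C. \<forall>N. norm (\<Sum>n=1..N. f n * ln n / of_nat n) \<le> C"
proof -
  define h where "h = (\<lambda>n. (ln (real n) / real n) *\<^sub>R f n)"
  have tail: "norm (\<Sum>n\<in>{3..<b}. h n) \<le> ln (real 3) / real 3 * B" for b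
    unfolding h_def
  proof (intro abel_summation_bound bounded)
    fix n :: nat assume n: "n \<ge> 3"
    have "exp 1 \<le> real n" using exp_le n by linarith
    thus "ln (real (Suc n)) / real (Suc n) \<le> ln (real n) / real n"
      by (intro ln_x_over_x_mono) auto
    show "0 \<le> ln (real n) / real n" using n by simp
  qed
  have "norm (\<Sum>n=1..N. f n * ln n / of_nat n) \<le> norm (h 1) + norm (h 2) + ln (real 3) / real 3 * B" for N
  proof -
    have "(\<Sum>n=1..N. f n * ln n / of_nat n) = (\<Sum>n=1..N. h n)"
      by (intro sum.cong) (auto simp: h_def scaleR_conv_of_real)
    also have "\<dots> = (\<Sum>n\<in>({1..N} \<inter> {1,2}) \<union> {3..<Suc N}. h n)"
      by (intro sum.cong) auto
    also have "\<dots> = (\<Sum>n\<in>{1..N} \<inter> {1,2}. h n) + (\<Sum>n\<in>{3..<Suc N}. h n)"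
      by (intro sum.union_disjoint) auto
    also have "norm \<dots> \<le> (\<Sum>n\<in>{1..N} \<inter> {1,2}. norm (h n)) + ln (real 3) / real 3 * B"
      by (intro order.trans[OF norm_triangle_ineq] add_mono norm_sum tail)
    also have "(\<Sum>n\<in>{1..N} \<inter> {1,2}. norm (h n)) \<le> (\<Sum>n\<in>{1,2}. norm (h n))"
      by (intro sum_mono2) auto
    finally show ?thesis by simp
  qed
  thus ?thesis by blast
qed

text \<open>
  Writing \<open>n = d * k\<close> turns the first sum into \<open>\<Sum>f(d) g(d)/d * partial_L (N div d)\<close>, because \<open>f\<close>
  is completely multiplicative. Replacing \<open>partial_L (N div d)\<close> by \<open>L\<close> costs at most \<open>B d / N\<close> in
  the \<open>d\<close>-th term, and this cancels the denominator \<open>d\<close>. The lemma is used twice: with \<open>g = \<Lambda>\<close>,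
  where the divisor sums are \<open>ln n\<close>, and with a weight built from the Moebius function, where they
  are \<open>\<Lambda>(n)\<close> up to the term \<open>n = 1\<close>.
\<close>

lemma divisor_sum_approx:
  fixes g :: "nat \<Rightarrow> real"
  assumes N: "N > 0"
  shows "norm ((\<Sum>n=1..N. f n / of_nat n * of_real (\<Sum>d | d dvd n. g d))
           - L * (\<Sum>d=1..N. f d * g d / of_nat d)) \<le> B / N * (\<Sum>d=1..N. \<bar>g d\<bar>)"
proof -
  have "(\<Sum>n=1..N. f n / of_nat n * of_real (\<Sum>d | d dvd n. g d)) =
        (\<Sum>n=1..N. \<Sum>d | d dvd n. f d * g d / of_nat d * (f (n div d) / of_nat (n div d)))"
  proof (intro sum.cong refl)
    fix n assume n: "n \<in> {1..N}"
    have "f n / of_nat n * of_real (\<Sum>d | d dvd n. g d) = (\<Sum>d | d dvd n. f n / of_nat n * g d)"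
      by (simp add: sum_distrib_left)
    also have "\<dots> = (\<Sum>d | d dvd n. f d * g d / of_nat d * (f (n div d) / of_nat (n div d)))"
    proof (intro sum.cong refl)
      fix d assume "d \<in> {d. d dvd n}"
      then obtain e where e: "n = d * e" by auto
      hence "d \<noteq> 0" "e \<noteq> 0" using n by auto
      thus "f n / of_nat n * g d = f d * g d / of_nat d * (f (n div d) / of_nat (n div d))"
        by (simp add: e mult)
    qed
    finally show "f n / of_nat n * of_real (\<Sum>d | d dvd n. g d) =
       (\<Sum>d | d dvd n. f d * g d / of_nat d * (f (n div d) / of_nat (n div d)))" .
  qed
  also have "\<dots> = (\<Sum>d=1..N. \<Sum>k=1..N div d. f d * g d / of_nat d * (f k / of_nat k))"
    by (rule sum_divisors_swap)
  also have "\<dots> = (\<Sum>d=1..N. f d * g d / of_nat d * partial_L (N div d))"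
    by (simp add: partial_L_def sum_distrib_left)
  finally have "(\<Sum>n=1..N. f n / of_nat n * of_real (\<Sum>d | d dvd n. g d))
           - L * (\<Sum>d=1..N. f d * g d / of_nat d) =
       (\<Sum>d=1..N. f d * g d / of_nat d * (partial_L (N div d) - L))"
    by (simp add: right_diff_distrib diff_divide_distrib sum_subtractf sum_distrib_left mult_ac)
  also have "norm \<dots> \<le> (\<Sum>d=1..N. norm (f d * g d / of_nat d * (partial_L (N div d) - L)))"
    by (rule norm_sum)
  also have "\<dots> \<le> (\<Sum>d=1..N. \<bar>g d\<bar> * (B / N))"
  proof (intro sum_mono)
    fix d assume d: "d \<in> {1..N}"
    have "norm (f d * g d / of_nat d * (partial_L (N div d) - L)) \<le>
          \<bar>g d\<bar> / d * norm (partial_L (N div d) - L)"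
      using norm_le[of d]
      by (auto simp: norm_mult norm_divide
          intro!: mult_right_mono divide_right_mono mult_left_le_one_le)
    also have "\<dots> \<le> \<bar>g d\<bar> / d * (B / (real (N div d) + 1))"
      using partial_L_approx[of "N div d"] by (intro mult_left_mono) (auto simp: add.commute)
    also have "\<dots> \<le> \<bar>g d\<bar> / d * (B / (N / d))"
      using real_div_less[of d N] d N B_nonneg by (intro mult_left_mono divide_left_mono) auto
    also have "\<dots> = \<bar>g d\<bar> * (B / N)"
      using d by simp
    finally show "norm (f d * g d / of_nat d * (partial_L (N div d) - L)) \<le> \<bar>g d\<bar> * (B / N)" .
  qed
  also have "\<dots> = B / N * (\<Sum>d=1..N. \<bar>g d\<bar>)"
    by (simp add: sum_distrib_left mult_ac)
  finally show ?thesis .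
qed

definition Lambda_sum :: "nat \<Rightarrow> complex" where
  "Lambda_sum N = (\<Sum>n=1..N. f n * mangoldt n / of_nat n)"

lemma Lambda_sum_bounded:
  assumes "L \<noteq> 0"
  shows "\<exists>C. \<forall>N. norm (Lambda_sum N) \<le> C"
proof -
  obtain C where C: "\<And>N. norm (\<Sum>n=1..N. f n * ln n / of_nat n) \<le> C"
    using sum_f_ln_bounded by blast
  have "norm (Lambda_sum N) \<le> (C + 4 * B) / norm L" for N
  proof (cases "N = 0")
    case True
    have "C \<ge> 0" using C[of 0] by simp
    thus ?thesis using B_nonneg True by (simp add: Lambda_sum_def)
  next
    case False
    define T where "T = (\<Sum>n=1..N. f n * ln n / of_nat n)"
    have "(\<Sum>n=1..N. f n / of_nat n * of_real (\<Sum>d | d dvd n. mangoldt d)) = T"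
      unfolding T_def by (intro sum.cong refl, subst mangoldt_sum) auto
    moreover have "(\<Sum>d=1..N. f d * of_real (mangoldt d) / of_nat d) = Lambda_sum N"
      by (simp add: Lambda_sum_def)
    moreover have "(\<Sum>d=1..N. \<bar>mangoldt d :: real\<bar>) = psi N"
      by (simp add: psi_def)
    ultimately have "norm (T - L * Lambda_sum N) \<le> B / N * psi N"
      using divisor_sum_approx[of N mangoldt] False by simp
    also have "\<dots> \<le> B / N * (4 * N)"
      using psi_le B_nonneg by (intro mult_left_mono) auto
    also have "\<dots> = 4 * B" using False by simp
    finally have "norm (L * Lambda_sum N) \<le> C + 4 * B"
      using C[of N] norm_triangle_ineq4[of T "T - L * Lambda_sum N"] by (simp add: T_def)
    thus ?thesis using assms by (simp add: norm_mult field_simps)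
  qed
  thus ?thesis by blast
qed

text \<open>
  If \<open>L = 0\<close>, then \<open>divisor_sum_approx\<close> has no main term. The weight
  \<open>g d = moebius d * ln (N / d)\<close> has divisor sums \<open>\<Lambda>(n)\<close>, with an additional \<open>ln N\<close> at \<open>n = 1\<close>, and
  \<open>\<Sum>\<bar>g d\<bar> \<le> \<Sum>ln (N / d) = N ln N - ln (N!) \<le> N\<close>.
\<close>

lemma Lambda_sum_of_zero_L:
  assumes "L = 0" "N > 0"
  shows "norm (Lambda_sum N + ln N) \<le> B"
proof -
  define g where "g = (\<lambda>d::nat. moebius d * (ln N - ln d))"
  have "(\<Sum>n=1..N. f n / of_nat n * of_real (\<Sum>d | d dvd n. g d)) =
        (\<Sum>n=1..N. f n / of_nat n * (mangoldt n + (if n = 1 then complex_of_real (ln N) else 0)))"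
  proof (intro sum.cong refl arg_cong2[of _ _ _ _ "(*)"])
    fix n assume "n \<in> {1..N}"
    hence n: "n > 0" by simp
    have "(\<Sum>d | d dvd n. g d) = ln N * (\<Sum>d | d dvd n. moebius d) - (\<Sum>d | d dvd n. moebius d * ln d)"
      by (simp add: g_def right_diff_distrib sum_subtractf sum_distrib_left mult.commute)
    thus "of_real (\<Sum>d | d dvd n. g d) = (mangoldt n + (if n = 1 then complex_of_real (ln N) else 0))"
      using sum_moebius[OF n] sum_moebius_ln[OF n] by simp
  qed
  also have "\<dots> = Lambda_sum N + (\<Sum>n=1..N. if n = 1 then complex_of_real (ln N) else 0)"
    unfolding Lambda_sum_def sum.distrib[symmetric] using one
    by (intro sum.cong) (auto simp: algebra_simps add_divide_distrib)
  also have "(\<Sum>n=1..N. if n = 1 then complex_of_real (ln N) else 0) = ln N"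
    using assms(2) by simp
  finally have "norm (Lambda_sum N + ln N) \<le> B / N * (\<Sum>d=1..N. \<bar>g d\<bar>)"
    using divisor_sum_approx[OF assms(2), of g] assms(1) by simp
  also have "\<dots> \<le> B / N * N"
  proof (intro mult_left_mono)
    have "(\<Sum>d=1..N. \<bar>g d\<bar>) \<le> (\<Sum>d=1..N. ln N - ln d)"
    proof (intro sum_mono)
      fix d assume d: "d \<in> {1..N}"
      have "\<bar>g d\<bar> = \<bar>moebius d\<bar> * (ln N - ln d)"
        using d by (simp add: g_def abs_mult)
      also have "\<dots> \<le> 1 * (ln N - ln d)"
        using d abs_moebius_le by (intro mult_right_mono) auto
      finally show "\<bar>g d\<bar> \<le> ln N - ln d" by simp
    qed
    also have "\<dots> = N * ln N - ln (fact N)"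
      by (simp add: sum_subtractf ln_fact_eq_sum_ln)
    also have "\<dots> \<le> N" using ln_fact_ge[of N] by simp
    finally show "(\<Sum>d=1..N. \<bar>g d\<bar>) \<le> N" .
  qed (use B_nonneg in auto)
  also have "\<dots> = B" using assms(2) by simp
  finally show ?thesis .
qed

end

section \<open>Nonvanishing of the value at 1\<close>

text \<open>
  Weight the inequality \<open>3 + 4 cos \<theta> + cos (2 \<theta>) \<ge> 0\<close> with \<open>\<Lambda>(n)/n\<close>. If the value at 1 were zero,
  the middle term would contribute \<open>- 4 ln N\<close>, which outweighs the \<open>3 ln N\<close> of the constant term.
  The term with \<open>f\<^sup>2\<close> is bounded above in
  either case: it is bounded if its own value at 1 is nonzero, and tends to minus infinity
  otherwise.
\<close>

lemma L_nonzero_of_square: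
  assumes f: "oscillating f B" and f2: "oscillating (\<lambda>n. f n ^ 2) B'"
    and unit: "\<And>n. f n = 0 \<or> norm (f n) = 1"
  shows "oscillating.L f \<noteq> 0"
proof
  assume L0: "oscillating.L f = 0"
  interpret f: oscillating f B by fact
  interpret f2: oscillating "\<lambda>n. f n ^ 2" B' by fact
  have "\<exists>C. \<forall>N>0. Re (f2.Lambda_sum N) \<le> C"
  proof (cases "f2.L = 0")
    case True
    have "Re (f2.Lambda_sum N) \<le> B'" if "N > 0" for N
    proof -
      have "Re (f2.Lambda_sum N) + ln N \<le> B'"
        using complex_Re_le_cmod[of "f2.Lambda_sum N + ln N"] f2.Lambda_sum_of_zero_L[OF True that] by simp
      moreover have "ln (real N) \<ge> 0" using that by simp
      ultimately show ?thesis by linarith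
    qed
    thus ?thesis by blast
  next
    case False
    then obtain C where "norm (f2.Lambda_sum N) \<le> C" for N using f2.Lambda_sum_bounded by blast
    hence "Re (f2.Lambda_sum N) \<le> C" for N by (rule order.trans[OF complex_Re_le_cmod])
    thus ?thesis by blast
  qed
  then obtain C where C: "\<And>N. N > 0 \<Longrightarrow> Re (f2.Lambda_sum N) \<le> C" by blast
  have pos: "0 \<le> 3 + 4 * Re (f n) + Re (f n ^ 2)" for n
  proof (cases "f n = 0")
    case False
    hence "(Re (f n))\<^sup>2 + (Im (f n))\<^sup>2 = 1"
      using unit[of n] by (simp add: cmod_def)
    hence "3 + 4 * Re (f n) + Re (f n ^ 2) = 2 * (1 + Re (f n))\<^sup>2"
      by (simp add: power2_eq_square algebra_simps)
    thus ?thesis by simp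
  qed simp
  have bound: "ln N \<le> 12 + 4 * B + C" if N: "N > 0" for N :: nat
  proof -
    have "0 \<le> (\<Sum>n=1..N. mangoldt n / n * (3 + 4 * Re (f n) + Re (f n ^ 2)))"
      by (intro sum_nonneg mult_nonneg_nonneg pos divide_nonneg_nonneg mangoldt_nonneg) simp
    also have "\<dots> = 3 * (\<Sum>n=1..N. mangoldt n / n) + 4 * Re (f.Lambda_sum N) + Re (f2.Lambda_sum N)"
      by (simp add: f.Lambda_sum_def f2.Lambda_sum_def Re_sum Re_divide_of_nat sum.distrib sum_distrib_left
          algebra_simps)
    also have "\<dots> \<le> 3 * (ln N + 4) + 4 * (B - ln N) + C"
      using mertens_upper[OF N] C[OF N] complex_Re_le_cmod[of "f.Lambda_sum N + ln N"] f.Lambda_sum_of_zero_L[OF L0 N]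
      by (intro add_mono mult_left_mono) auto
    finally show ?thesis by simp
  qed
  obtain N :: nat where "exp (12 + 4 * B + C) < N" using reals_Archimedean2 by blast
  moreover from this have "N > 0" using exp_gt_zero[of "12 + 4 * B + C"]
    by (auto intro!: Nat.gr0I simp del: exp_gt_zero)
  ultimately have "12 + 4 * B + C < ln N"
    using ln_less_cancel_iff[of "exp (12 + 4 * B + C)" N] by simp
  thus False using bound[OF \<open>N > 0\<close>] by simp
qed

text \<open>
  The function \<open>n \<mapsto> \<Sum>c d\<close> over the divisors \<open>d\<close> of \<open>n\<close> is multiplicative; for a real character it
  is the coefficient sequence of the Lambert series. By induction along this identity its values are
  nonnegative, and at least 1 at squares, since this holds for the geometric sums of \<open>-1\<close>, \<open>0\<close>
  and \<open>1\<close>.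
\<close>

lemma divisor_sum_prime_power_mult:
  fixes c :: "nat \<Rightarrow> real"
  assumes mult: "\<And>a b. c (a * b) = c a * c b" and one: "c 1 = 1"
    and p: "prime p" and n: "\<not> p dvd n"
  shows "(\<Sum>d | d dvd p ^ k * n. c d) = (\<Sum>i\<le>k. c p ^ i) * (\<Sum>d | d dvd n. c d)"
proof -
  have pow: "c (p ^ i) = c p ^ i" for i by (induction i) (simp_all add: mult one[simplified])
  have inj: "inj_on (\<lambda>(i, d). p ^ i * d) ({..k} \<times> {d. d dvd n})"
  proof (rule inj_onI, clarsimp)
    fix i d j e assume *: "d dvd n" "e dvd n" "p ^ i * d = p ^ j * e"
    hence nd: "\<not> p dvd d" "\<not> p dvd e" using n dvd_trans by blast+
    have "multiplicity p (p ^ i * d) = i" "multiplicity p (p ^ j * e) = j"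
      using nd p by (auto intro!: multiplicity_eqI simp: dvd_mult_cancel_left)
    hence "i = j" using * by simp
    thus "i = j \<and> d = e" using * p by (simp add: prime_gt_0_nat)
  qed
  have "(\<lambda>(i, d). p ^ i * d) ` ({..k} \<times> {d. d dvd n}) = {d. d dvd p ^ k * n}"
  proof (intro equalityI subsetI)
    fix x assume "x \<in> {d. d dvd p ^ k * n}"
    then obtain a b where "x = a * b" "a dvd p ^ k" "b dvd n"
      using division_decomp[of x "p ^ k" n] by blast
    moreover from this obtain i where "i \<le> k" "a = p ^ i"
      using divides_primepow_nat[OF p] by blast
    ultimately show "x \<in> (\<lambda>(i, d). p ^ i * d) ` ({..k} \<times> {d. d dvd n})" by force
  qed (auto intro!: mult_dvd_mono le_imp_power_dvd)
  hence "(\<Sum>d | d dvd p ^ k * n. c d) = (\<Sum>(i, d)\<in>{..k} \<times> {d. d dvd n}. c (p ^ i * d))"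
    using sum.reindex[OF inj, of c] by (simp add: case_prod_unfold)
  also have "\<dots> = (\<Sum>i\<le>k. \<Sum>d | d dvd n. c p ^ i * c d)"
    by (simp add: sum.cartesian_product mult pow)
  also have "\<dots> = (\<Sum>i\<le>k. c p ^ i) * (\<Sum>d | d dvd n. c d)"
    by (simp add: sum_product)
  finally show ?thesis .
qed

lemma geometric_sum_sign:
  fixes x :: real
  assumes "x \<in> {-1, 0, 1}"
  shows "(\<Sum>i\<le>k. x ^ i) \<ge> (if even k then 1 else 0)"
proof -
  have "(\<Sum>i\<le>k. (-1::real) ^ i) = (if even k then 1 else 0)" by (induction k) auto
  thus ?thesis using assms by (auto simp: power_0_left sum.delta)
qed

lemma divisor_sum_nonneg:
  fixes c :: "nat \<Rightarrow> real"
  assumes mult: "\<And>a b. c (a * b) = c a * c b" and one: "c 1 = 1" and sign: "\<And>n. c n \<in> {-1, 0, 1}"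
  shows "n > 0 \<Longrightarrow> (\<Sum>d | d dvd n. c d) \<ge> 0"
proof (induction n rule: less_induct)
  case (less n)
  show ?case
  proof (cases "n = 1")
    case False
    hence "n > 1" using less.prems by simp
    then obtain p k n' where n: "prime p" "k > 0" "\<not> p dvd n'" "n = p ^ k * n'" "n' > 0" "n' < n"
      by (rule prime_power_split)
    have "0 \<le> (\<Sum>d | d dvd n'. c d)" using less.IH[OF n(6,5)] .
    moreover have "0 \<le> (\<Sum>i\<le>k. c p ^ i)"
      using geometric_sum_sign[OF sign[of p], of k] by (auto split: if_splits)
    ultimately show ?thesis
      unfolding n(4) divisor_sum_prime_power_mult[OF mult one n(1,3)] by (rule mult_nonneg_nonneg[rotated])
  qed (use one in simp)
qed

lemma divisor_sum_square_ge_1: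
  fixes c :: "nat \<Rightarrow> real"
  assumes mult: "\<And>a b. c (a * b) = c a * c b" and one: "c 1 = 1" and sign: "\<And>n. c n \<in> {-1, 0, 1}"
  shows "s > 0 \<Longrightarrow> (\<Sum>d | d dvd s\<^sup>2. c d) \<ge> 1"
proof (induction s rule: less_induct)
  case (less s)
  show ?case
  proof (cases "s = 1")
    case False
    hence "s > 1" using less.prems by simp
    then obtain p k t where s: "prime p" "k > 0" "\<not> p dvd t" "s = p ^ k * t" "t > 0" "t < s"
      by (rule prime_power_split)
    have t: "1 \<le> (\<Sum>d | d dvd t\<^sup>2. c d)" using less.IH[OF s(6,5)] .
    have nd: "\<not> p dvd t\<^sup>2" using s prime_dvd_power by blast
    have "s\<^sup>2 = p ^ (2 * k) * t\<^sup>2"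
      by (simp add: s(4) power_mult_distrib power_mult power2_eq_square)
    hence "(\<Sum>d | d dvd s\<^sup>2. c d) = (\<Sum>i\<le>2 * k. c p ^ i) * (\<Sum>d | d dvd t\<^sup>2. c d)"
      using divisor_sum_prime_power_mult[OF mult one s(1) nd] by simp
    moreover have "1 \<le> (\<Sum>i\<le>2 * k. c p ^ i)"
      using geometric_sum_sign[OF sign[of p], of "2 * k"] by simp
    ultimately show ?thesis
      using t mult_mono[of 1 "\<Sum>i\<le>2 * k. c p ^ i" 1 "\<Sum>d | d dvd t\<^sup>2. c d"] by simp
  qed (use one in simp)
qed

text \<open>
  The inequality of arithmetic and geometric means for the powers of \<open>u\<^sup>2\<close>, where the terms \<open>i\<close>
  and \<open>n - 1 - i\<close> are paired. The base is a square to avoid half-integral exponents.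
\<close>

lemma geometric_sum_ge:
  fixes u :: real
  assumes "u \<ge> 0"
  shows "(\<Sum>i<n. (u\<^sup>2) ^ i) \<ge> n * u ^ (n - 1)"
proof -
  have "2 * (n * u ^ (n - 1)) = (\<Sum>i<n. 2 * u ^ (n - 1))" by simp
  also have "\<dots> \<le> (\<Sum>i<n. (u\<^sup>2) ^ i + (u\<^sup>2) ^ (n - Suc i))"
  proof (intro sum_mono)
    fix i assume "i \<in> {..<n}"
    hence "u ^ (n - 1) = u ^ i * u ^ (n - Suc i)" by (simp flip: power_add)
    moreover have "0 \<le> (u ^ i - u ^ (n - Suc i))\<^sup>2" by simp
    ultimately show "2 * u ^ (n - 1) \<le> (u\<^sup>2) ^ i + (u\<^sup>2) ^ (n - Suc i)"
      by (simp add: power2_eq_square algebra_simps power_mult_distrib)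
  qed
  also have "\<dots> = 2 * (\<Sum>i<n. (u\<^sup>2) ^ i)"
    by (simp add: sum.distrib sum.nat_diff_reindex)
  finally show ?thesis by simp
qed

lemma frac_le_cross: "0 < a \<Longrightarrow> 0 < b \<Longrightarrow> x * b \<le> a \<Longrightarrow> x / a \<le> 1 / (b::real)"
  by (simp add: field_simps)

text \<open>
  The expression \<open>1/n - t\<^sup>n / G n\<close> is \<open>1 - t\<close> times the difference between \<open>1/(n (1 - t))\<close> and the
  factor \<open>t\<^sup>n/(1 - t\<^sup>n)\<close> of the Lambert series. Since
  \<open>t ^ n / G n - t ^ (n+1) / G (n+1) = t ^ n / (G n * G (n+1))\<close>, monotonicity is the inequality
  \<open>n (n+1) t\<^sup>n \<le> G n * G (n+1)\<close>, which follows from \<open>geometric_sum_ge\<close>.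
\<close>

lemma lambert_difference_mono:
  fixes t :: real
  assumes t: "0 < t" "t < 1" and n: "n > 0"
  defines "G \<equiv> \<lambda>n. \<Sum>i<n. t ^ i"
  shows "1 / real (Suc n) - t ^ Suc n / G (Suc n) \<le> 1 / n - t ^ n / G n"
    and "1 / n - t ^ n / G n \<ge> 0"
proof -
  define u where "u = sqrt t"
  have u: "u \<ge> 0" "u \<le> 1" "u\<^sup>2 = t" using t by (auto simp: u_def)
  have Gpos: "G k > 0" if "k > 0" for k
    unfolding G_def using that t by (intro sum_pos) auto
  have G: "G k \<ge> k * u ^ (k - 1)" for k
    using geometric_sum_ge[OF u(1), of k] u by (simp add: G_def)
  have tn: "t ^ n = u ^ n * u ^ n" using u(3) by (metis power2_eq_square power_mult_distrib)
  have "u ^ n \<le> u ^ (n - 1)" using u by (intro power_decreasing) auto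
  hence *: "n * u ^ n \<le> G n" using G[of n] by (meson mult_left_mono of_nat_0_le_iff order.trans)
  have "n * (n + 1) * t ^ n = (n * u ^ n) * ((n + 1) * u ^ n)"
    by (simp add: tn algebra_simps)
  also have "\<dots> \<le> G n * G (Suc n)"
    using * G[of "Suc n"] u Gpos[OF n] by (intro mult_mono) auto
  finally have key: "n * (n + 1) * t ^ n \<le> G n * G (Suc n)" .
  have "t ^ n / G n - t ^ Suc n / G (Suc n) = t ^ n / (G n * G (Suc n))"
  proof -
    have "G (Suc n) = 1 + t * G n"
      unfolding G_def sum.lessThan_Suc_shift by (simp add: sum_distrib_left)
    thus ?thesis using Gpos[OF n] Gpos[of "Suc n"] by (simp add: divide_simps) (simp add: algebra_simps)
  qed
  also have "\<dots> \<le> 1 / (n * (n + 1))"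
    using key n Gpos[OF n] Gpos[of "Suc n"]
    by (intro frac_le_cross) (auto intro!: mult_pos_pos add_pos_nonneg simp: mult.commute)
  also have "\<dots> = 1 / n - 1 / Suc n"
    using n add_pos_nonneg[of "real n" "real n * real n"]
    by (simp add: divide_simps del: of_nat_Suc) (simp add: algebra_simps)
  finally show "1 / real (Suc n) - t ^ Suc n / G (Suc n) \<le> 1 / n - t ^ n / G n" by simp
  have "n * t ^ n \<le> n * u ^ n"
    unfolding tn using u by (intro mult_left_mono mult_left_le_one_le) (auto simp: power_le_one)
  hence "n * t ^ n \<le> G n" using * by linarith
  thus "1 / n - t ^ n / G n \<ge> 0" using n Gpos[OF n] by (simp add: divide_simps mult.commute)
qed

text \<open>
  Truncating each geometric series \<open>t ^ d + t ^ (2 * d) + \<dots>\<close> of the Lambert sum at exponents up to \<open>N\<close> changes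
  it by at most \<open>t\<^sup>N/(1 - t)\<close>. The truncated sums combine to \<open>\<Sum>r(j) t\<^sup>j\<close> over \<open>j \<le> N\<close>, where \<open>r\<close> is
  the divisor sum of \<open>c\<close>; only the squares are kept.
\<close>

lemma squares_le_lambert_sum:
  fixes c :: "nat \<Rightarrow> real" and t :: real
  assumes c: "\<And>a b. c (a * b) = c a * c b" "c 1 = 1" "\<And>n. c n \<in> {-1, 0, 1}"
    and t: "0 < t" "t < 1" and KN: "K\<^sup>2 \<le> N"
  shows "(\<Sum>s=1..K. t ^ s\<^sup>2) \<le> (\<Sum>d=1..N. c d * (t ^ d / (1 - t ^ d))) + N * t ^ N / (1 - t)"
proof -
  define r where "r = (\<lambda>n. \<Sum>d | d dvd n. c d)"
  have "(\<Sum>s=1..K. t ^ s\<^sup>2) \<le> (\<Sum>s=1..K. r (s\<^sup>2) * t ^ s\<^sup>2)"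
    using divisor_sum_square_ge_1[OF c] t by (intro sum_mono) (auto simp: r_def)
  also have "\<dots> = (\<Sum>j\<in>power2 ` {1..K}. r j * t ^ j)"
    by (subst sum.reindex) (auto simp: inj_on_def)
  also have "\<dots> \<le> (\<Sum>j=1..N. r j * t ^ j)"
  proof (intro sum_mono2)
    show "power2 ` {1..K} \<subseteq> {1..N}"
    proof
      fix x assume "x \<in> power2 ` {1..K}"
      then obtain s where s: "x = s\<^sup>2" "1 \<le> s" "s \<le> K" by auto
      have "s\<^sup>2 \<le> N" using power_mono[OF s(3) le0, of 2] KN by linarith
      thus "x \<in> {1..N}" using s by (simp add: Suc_leI)
    qed
    show "0 \<le> r j * t ^ j" if "j \<in> {1..N} - power2 ` {1..K}" for j
      using divisor_sum_nonneg[OF c, of j] t that by (auto simp: r_def)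
  qed auto
  also have "\<dots> = (\<Sum>j=1..N. \<Sum>d | d dvd j. c d * t ^ (d * (j div d)))"
    unfolding r_def sum_distrib_right by (intro sum.cong) auto
  also have "\<dots> = (\<Sum>d=1..N. \<Sum>k=1..N div d. c d * t ^ (d * k))"
    by (rule sum_divisors_swap)
  also have "\<dots> \<le> (\<Sum>d=1..N. c d * (t ^ d / (1 - t ^ d)) + t ^ N / (1 - t))"
  proof (intro sum_mono)
    fix d assume d: "d \<in> {1..N}"
    define q where "q = N div d"
    define x where "x = t ^ d"
    have x: "0 < x" "x < 1" "x \<le> t"
      using t d power_decreasing[of 1 d t]
      by (auto simp: x_def power_Suc_less_one intro: power_less_one_iff[THEN iffD2])
    have "(\<Sum>k=1..q. x ^ k) = x * (\<Sum>k<q. x ^ k)"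
      by (simp add: sum_distrib_left sum.atLeast1_atMost_eq)
    also have "\<dots> = x / (1 - x) - x ^ Suc q / (1 - x)"
      using x by (simp add: geometric_sum divide_simps) (simp add: algebra_simps)
    finally have sum: "(\<Sum>k=1..q. x ^ k) = x / (1 - x) - x ^ Suc q / (1 - x)" .
    have "N mod d < d" using d by simp
    hence "N \<le> d * Suc q"
      using div_mult_mod_eq[of N d] unfolding q_def mult_Suc_right mult.commute[of d] by linarith
    hence "x ^ Suc q \<le> t ^ N"
      using t power_decreasing[of N "d * Suc q" t] by (simp add: x_def flip: power_mult del: power_Suc)
    hence rem: "x ^ Suc q / (1 - x) \<le> t ^ N / (1 - t)" "0 \<le> x ^ Suc q / (1 - x)"
      using x t by (auto intro!: frac_le simp del: power_Suc)
    have "(\<Sum>k=1..q. c d * t ^ (d * k)) = c d * (\<Sum>k=1..q. x ^ k)"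
      by (simp add: x_def sum_distrib_left power_mult)
    also have "\<dots> = c d * (x / (1 - x)) - c d * (x ^ Suc q / (1 - x))"
      unfolding sum by (simp add: algebra_simps)
    also have "\<dots> \<le> c d * (x / (1 - x)) + t ^ N / (1 - t)"
      using rem c(3)[of d] by auto
    finally show "(\<Sum>k=1..N div d. c d * t ^ (d * k)) \<le> c d * (t ^ d / (1 - t ^ d)) + t ^ N / (1 - t)"
      by (simp add: x_def q_def)
  qed
  also have "\<dots> = (\<Sum>d=1..N. c d * (t ^ d / (1 - t ^ d))) + N * t ^ N / (1 - t)"
    by (simp add: sum.distrib)
  finally show ?thesis .
qed

context oscillating
begin

text \<open>
  The comparison series \<open>\<Sum>c(d)/(d (1 - t))\<close> is small for large \<open>N\<close> because \<open>L = 0\<close>. The difference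
  has decreasing coefficients, so partial summation bounds it by \<open>B\<close> times its first coefficient,
  which is 1. This bound does not depend on \<open>t\<close>.
\<close>

lemma lambert_sum_le:
  fixes c :: "nat \<Rightarrow> real"
  assumes f: "\<And>n. f n = of_real (c n)" and L0: "L = 0" and t: "0 < t" "t < 1"
  shows "(\<Sum>d=1..N. c d * (t ^ d / (1 - t ^ d))) \<le> B / (N + 1) / (1 - t) + B"
proof -
  have cB: "norm (\<Sum>n\<in>{a..<b}. c n) \<le> B" for a b
    using bounded[of a b] unfolding f of_real_sum[symmetric] norm_of_real by simp
  define G where "G = (\<lambda>n. \<Sum>i<n. t ^ i)"
  define b where "b = (\<lambda>n::nat. 1 / n - t ^ n / G n)"
  have G1: "1 - t ^ n = (1 - t) * G n" for n
    by (simp add: G_def one_diff_power_eq)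
  have Gge: "G n \<ge> 1" if "n > 0" for n
  proof -
    have "(\<Sum>i<1. t ^ i) \<le> G n"
      unfolding G_def using that t by (intro sum_mono2) auto
    thus ?thesis by simp
  qed
    have "(\<Sum>d=1..N. c d * (t ^ d / (1 - t ^ d))) =
        ((\<Sum>d=1..N. c d / d) - (\<Sum>d=1..N. b d * c d)) / (1 - t)"
      unfolding sum_subtractf[symmetric] sum_divide_distrib
    proof (intro sum.cong refl)
      fix d assume "d \<in> {1..N}"
      hence "G d \<noteq> 0" using Gge[of d] by auto
      thus "c d * (t ^ d / (1 - t ^ d)) = (c d / d - b d * c d) / (1 - t)"
        using t by (simp add: G1 b_def algebra_simps)
    qed
    also have "\<dots> \<le> (B / (N + 1) + (1 - t) * B) / (1 - t)"
    proof (intro divide_right_mono)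
      have "(\<Sum>d=1..N. c d / d) = Re (partial_L N)"
        by (simp add: partial_L_def f Re_divide_of_nat)
      also have "\<dots> \<le> B / (N + 1)"
        using complex_Re_le_cmod[of "partial_L N"] partial_L_approx[of N] L0 by (simp add: add.commute)
      finally have 1: "(\<Sum>d=1..N. c d / d) \<le> B / (N + 1)" .
      have "norm (\<Sum>n\<in>{1..<Suc N}. b n *\<^sub>R c n) \<le> b 1 * B"
      proof (intro abel_summation_bound cB)
        show "b (Suc n) \<le> b n" "0 \<le> b n" if "n \<ge> 1" for n
          using lambert_difference_mono[OF t, of n] that by (simp_all add: b_def G_def)
      qed
      moreover have "{1..<Suc N} = {1..N}" by auto
      moreover have "b 1 = 1 - t" by (simp add: b_def G_def)
      ultimately have "\<bar>\<Sum>d=1..N. b d * c d\<bar> \<le> (1 - t) * B"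
        by (simp only: real_norm_def real_scaleR_def)
      hence "- (\<Sum>d=1..N. b d * c d) \<le> (1 - t) * B" by linarith
      thus "(\<Sum>d=1..N. c d / d) - (\<Sum>d=1..N. b d * c d) \<le> B / (N + 1) + (1 - t) * B"
        using 1 by simp
    qed (use t in simp)
    also have "\<dots> = B / (N + 1) / (1 - t) + B"
      using t by (simp add: add_divide_distrib)
    finally show ?thesis .
qed

text \<open>
  Combining the two bounds and letting \<open>N\<close> tend to infinity for fixed \<open>t\<close> bounds the sum of
  \<open>t ^ s\<^sup>2\<close> over \<open>s \<le> K\<close> by \<open>B\<close>, for all \<open>K\<close> and all \<open>t < 1\<close>. For \<open>t\<close> close to 1 this sum is at
  least \<open>K / 2\<close>.
\<close>

lemma L_nonzero_real:
  assumes real: "\<And>n. f n \<in> {-1, 0, 1}"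
  shows "L \<noteq> 0"
proof
  assume L0: "L = 0"
  define c where "c = (\<lambda>n. Re (f n))"
  have f: "f n = of_real (c n)" for n using real[of n] by (auto simp: c_def)
  have c: "c (a * b) = c a * c b" "c 1 = 1" for a b
    using mult[of a b] one by (simp_all add: f complex_eq_iff)
  have sign: "c n \<in> {-1, 0, 1}" for n
    using real[of n] by (auto simp: c_def)
  have finite_bound: "(\<Sum>s=1..K. t ^ s\<^sup>2) \<le> B / (N + 1) / (1 - t) + B + N * t ^ N / (1 - t)"
    if t: "0 < t" "t < 1" and KN: "K\<^sup>2 \<le> N" for t :: real and K N :: nat
    using squares_le_lambert_sum[of c, OF c sign t KN] lambert_sum_le[OF f L0 t, of N] by linarith
  have limit_bound: "(\<Sum>s=1..K. t ^ s\<^sup>2) \<le> B" if t: "0 < t" "t < 1" for t :: real and K :: nat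
  proof (rule tendsto_lowerbound)
    have "(\<lambda>N. real N * t ^ N) \<longlonglongrightarrow> 0"
      using powser_times_n_limit_0[of t] t by simp
    moreover have "(\<lambda>N. B / (real N + 1)) \<longlonglongrightarrow> 0"
      using tendsto_mult[OF tendsto_const[of B] LIMSEQ_inverse_real_of_nat] by (simp add: field_simps)
    ultimately have "(\<lambda>N. B / (real N + 1) / (1 - t) + B + real N * t ^ N / (1 - t)) \<longlonglongrightarrow> 0 / (1 - t) + B + 0 / (1 - t)"
      by (intro tendsto_add tendsto_divide tendsto_const) (use t in auto)
    thus "(\<lambda>N. B / (real N + 1) / (1 - t) + B + real N * t ^ N / (1 - t)) \<longlonglongrightarrow> B" by simp
    show "\<forall>\<^sub>F N in sequentially. (\<Sum>s=1..K. t ^ s\<^sup>2) \<le> B / (real N + 1) / (1 - t) + B + real N * t ^ N / (1 - t)"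
      using finite_bound[OF t] by (intro eventually_sequentiallyI[of "K\<^sup>2"]) (simp add: add.commute)
  qed simp
  obtain K :: nat where K: "2 * B + 1 < K" using reals_Archimedean2 by blast
  hence K0: "real K \<ge> 1" using B_nonneg by simp
  \<comment> \<open>Chosen so that Bernoulli's inequality gives \<open>t ^ s\<^sup>2 \<ge> 1/2\<close> for all \<open>s \<le> K\<close>.\<close>
  define t where "t = 1 - 1 / (2 * (real K)\<^sup>2)"
  have K2: "(real K)\<^sup>2 \<ge> 1" using K0 by (simp add: one_le_power)
  have "1 < 2 * (real K)\<^sup>2" using K2 by linarith
  hence "1 / (2 * (real K)\<^sup>2) < 1" "1 / (2 * (real K)\<^sup>2) > 0"
    using K0 by simp_all
  hence t: "0 < t" "t < 1" by (simp_all add: t_def)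
  have "K / 2 = (\<Sum>s=1..K. 1 / 2 :: real)" by simp
  also have "\<dots> \<le> (\<Sum>s=1..K. t ^ s\<^sup>2)"
  proof (intro sum_mono)
    fix s assume s: "s \<in> {1..K}"
    have "real (s\<^sup>2) \<le> (real K)\<^sup>2" using s by (simp add: power_mono)
    hence "real (s\<^sup>2) / (real K)\<^sup>2 \<le> 1" using K0 by (simp add: divide_le_eq_1)
    hence "1 / 2 \<le> 1 - (real (s\<^sup>2) / (real K)\<^sup>2) / 2" by simp
    also have "\<dots> = 1 + real (s\<^sup>2) * (t - 1)" by (simp add: t_def)
    also have "\<dots> \<le> t ^ s\<^sup>2"
      using Bernoulli_inequality[of "t - 1" "s\<^sup>2"] t by simp
    finally show "1 / 2 \<le> t ^ s\<^sup>2" .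
  qed
  also have "\<dots> \<le> B" by (rule limit_bound[OF t])
  finally show False using K by simp
qed

end

lemma oscillating_dchars:
  assumes "\<chi> \<in> dchars m" "\<chi> \<noteq> principal_char m" "m > 0"
  shows "oscillating \<chi> (2 * m)"
  using nonprincipal_sum_bounded[OF assms] norm_dchars_le[OF assms(1,3)] dchars_1[OF assms(1)]
    dchars_mult[OF assms(1)] by unfold_locales auto

lemma nonprincipal_L_nonzero:
  assumes "\<chi> \<in> dchars m" "\<chi> \<noteq> principal_char m" "m > 0"
  shows "oscillating.L \<chi> \<noteq> 0"
proof (cases "(\<lambda>n. \<chi> n ^ 2) = principal_char m")
  case False
  have "(\<lambda>n. \<chi> n ^ 2) \<in> dchars m"
    using dchars_times[OF assms(1,1)] by (simp add: power2_eq_square)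
  thus ?thesis
    using L_nonzero_of_square[OF oscillating_dchars[OF assms] oscillating_dchars[OF _ False assms(3)]]
      norm_dchars[OF assms(1,3)] dchars_eq_0_iff[OF assms(1)] by blast
next
  case True
  have "\<chi> n \<in> {-1, 0, 1}" for n
  proof -
    have "\<chi> n ^ 2 = 0 \<or> \<chi> n ^ 2 = 1" using fun_cong[OF True, of n] by (auto simp: principal_char_def)
    thus ?thesis by (auto simp: power2_eq_1_iff)
  qed
  thus ?thesis by (intro oscillating.L_nonzero_real[OF oscillating_dchars[OF assms]])
qed

section \<open>The contribution of higher prime powers\<close>

text \<open>
  With \<open>b = sqrt n\<close> we have \<open>ln n \<le> 2 b\<close>, so the left-hand side is at most \<open>2 / b\<^sup>3\<close>. The
  right-hand side telescopes, so the sum over \<open>n\<close> is bounded without an integral comparison.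
\<close>

lemma ln_over_square_telescope:
  assumes "n \<ge> 2"
  shows "ln (real n) / (real n)\<^sup>2 \<le> 4 * (1 / sqrt (real (n - 1)) - 1 / sqrt (real n))"
proof -
  \<comment> \<open>The estimate is \<open>1/a - 1/b = 1/(a b (a + b)) \<ge> 1/(2 b\<^sup>3)\<close>, as \<open>b\<^sup>2 - a\<^sup>2 = 1\<close>.\<close>
  define a where "a = sqrt (real (n - 1))"
  define b where "b = sqrt (real n)"
  have a: "a > 0" and ab: "a \<le> b" and b: "b > 0" using assms by (auto simp: a_def b_def)
  have sq: "a\<^sup>2 = real n - 1" "b\<^sup>2 = real n" using assms by (auto simp: a_def b_def of_nat_diff)
  have "ln (real n) = 2 * ln b" using b by (simp add: ln_realpow flip: sq(2))
  also have "\<dots> \<le> 2 * b" using ln_less_self[OF b] by simp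
  finally have "ln (real n) / (real n)\<^sup>2 \<le> 2 * b / (b\<^sup>2)\<^sup>2"
    unfolding sq(2)[symmetric] by (intro divide_right_mono) auto
  also have "\<dots> = 4 * (1 / (b * b * (b + b)))"
    using b by (simp add: field_simps power2_eq_square)
  also have "\<dots> \<le> 4 * (1 / (a * b * (a + b)))"
    using a b ab by (intro mult_left_mono divide_left_mono mult_mono mult_pos_pos) auto
  also have "1 / (a * b * (a + b)) = (b\<^sup>2 - a\<^sup>2) / (a * b * (a + b))"
    unfolding sq by simp
  also have "\<dots> = 1 / a - 1 / b"
    using a b by (simp add: divide_simps) (simp add: power2_eq_square algebra_simps)
  finally show ?thesis by (simp add: a_def b_def)
qed

lemma sum_ln_over_square_le: "(\<Sum>n=2..N. ln (real n) / (real n)\<^sup>2) \<le> 4"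
proof (cases "N \<ge> 1")
  case True
  have "(\<Sum>n=2..N. ln (real n) / (real n)\<^sup>2) \<le>
        (\<Sum>n=2..N. 4 * (1 / sqrt (real (n - 1)) - 1 / sqrt (real n)))"
    by (intro sum_mono ln_over_square_telescope) auto
  also have "\<dots> = 4 * (1 - 1 / sqrt N)"
    using True by (induction N rule: dec_induct) (simp_all add: algebra_simps)
  also have "\<dots> \<le> 4" by simp
  finally show ?thesis .
qed simp

text \<open>
  The terms are \<open>ln p / p\<^sup>k\<close> with \<open>k \<ge> 2\<close>. For each \<open>p\<close> the geometric series gives at most
  \<open>2 ln p / p\<^sup>2\<close>.
\<close>

lemma sum_mangoldt_nonprime_le:
  "(\<Sum>n | n \<in> {1..N} \<and> \<not> prime n. mangoldt n / n) \<le> (8::real)"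
proof -
  \<comment> \<open>The range \<open>k < N\<close> of exponents \<open>k + 2\<close> suffices, since \<open>p ^ j \<le> N\<close> forces \<open>j < N\<close>.\<close>
  define I where "I = {p \<in> {2..N}. prime p} \<times> {..<N}"
  define S where "S = {n \<in> {1..N}. primepow n \<and> \<not> prime n}"
  have fin: "finite I" by (simp add: I_def)
  have S: "S \<subseteq> (\<lambda>(p, k). p ^ (k + 2)) ` I"
  proof
    fix n assume "n \<in> S"
    then obtain p j where n: "prime p" "j > 0" "n = p ^ j" "n \<le> N" "\<not> prime n"
      by (auto simp: S_def primepow_def)
    have "j \<noteq> 1" using n by auto
    then obtain k where k: "j = k + 2" using n(2)
      by (metis Suc_1 add_2_eq_Suc' less_one not0_implies_Suc One_nat_def gr0_conv_Suc)
    have "p \<ge> 2" by (rule prime_ge_2_nat) fact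
    have "j < p ^ j" using \<open>p \<ge> 2\<close> by (intro less_exp[THEN order.strict_trans2] power_mono) auto
    hence "k < N" using k n by simp
    moreover have "p ^ 1 \<le> p ^ j" using \<open>p \<ge> 2\<close> n(2) by (intro power_increasing) auto
    hence "p \<le> N" using n by simp
    ultimately show "n \<in> (\<lambda>(p, k). p ^ (k + 2)) ` I"
      using n \<open>p \<ge> 2\<close> k by (auto simp: I_def intro!: image_eqI[of _ _ "(p, k)"])
  qed
  have "(\<Sum>n | n \<in> {1..N} \<and> \<not> prime n. mangoldt n / n) = (\<Sum>n\<in>S. mangoldt n / real n)"
    by (intro sum.mono_neutral_right) (auto simp: S_def mangoldt_def)
  also have "\<dots> \<le> (\<Sum>n\<in>(\<lambda>(p, k). p ^ (k + 2)) ` I. mangoldt n / real n)"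
    by (intro sum_mono2 S finite_imageI fin) (auto simp: mangoldt_nonneg)
  also have "\<dots> \<le> (\<Sum>i\<in>I. mangoldt (case i of (p, k) \<Rightarrow> p ^ (k + 2)) / real (case i of (p, k) \<Rightarrow> p ^ (k + 2)))"
    by (intro order.trans[OF sum_image_le[OF fin]]) (auto simp: mangoldt_nonneg)
  also have "\<dots> = (\<Sum>(p,k)\<in>I. ln p / (real p)\<^sup>2 * (1 / real p) ^ k)"
  proof (intro sum.cong refl)
    fix i assume "i \<in> I"
    then obtain p k where i: "i = (p, k)" "prime p" by (auto simp: I_def)
    have "mangoldt (p ^ (k + 2)) = ln (real p)"
      using mangoldt_primepow[OF i(2), of "k + 2", where 'a = real] by simp
    thus "mangoldt (case i of (p, k) \<Rightarrow> p ^ (k + 2)) / real (case i of (p, k) \<Rightarrow> p ^ (k + 2)) =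
          (case i of (p, k) \<Rightarrow> ln p / (real p)\<^sup>2 * (1 / real p) ^ k)"
      unfolding i by (simp add: power_add power_divide power2_eq_square)
  qed
  also have "\<dots> = (\<Sum>p | p \<in> {2..N} \<and> prime p. \<Sum>k<N. ln p / (real p)\<^sup>2 * (1 / real p) ^ k)"
    by (simp add: I_def sum.cartesian_product)
  also have "\<dots> \<le> (\<Sum>p | p \<in> {2..N} \<and> prime p. ln p / (real p)\<^sup>2 * 2)"
  proof (intro sum_mono)
    fix p assume "p \<in> {p. p \<in> {2..N} \<and> prime p}"
    hence p: "p \<ge> 2" by simp
    define x where "x = 1 / real p"
    have x: "0 < x" "x \<le> 1 / 2" using p by (auto simp: x_def field_simps)
    have "(\<Sum>k<N. x ^ k) = (1 - x ^ N) / (1 - x)"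
      using x by (simp add: geometric_sum divide_simps) (simp add: algebra_simps)
    also have "\<dots> \<le> 1 / (1 / 2)" using x by (intro frac_le) (auto simp: power_le_one)
    finally have "(\<Sum>k<N. x ^ k) \<le> 2" by simp
    thus "(\<Sum>k<N. ln p / (real p)\<^sup>2 * (1 / real p) ^ k) \<le> ln p / (real p)\<^sup>2 * 2"
      using p unfolding sum_distrib_left[symmetric] x_def by (intro mult_left_mono) auto
  qed
  also have "\<dots> \<le> (\<Sum>p=2..N. ln p / (real p)\<^sup>2 * 2)"
    by (intro sum_mono2) auto
  also have "\<dots> = 2 * (\<Sum>p=2..N. ln p / (real p)\<^sup>2)"
    by (simp add: sum_distrib_left mult.commute)
  also have "\<dots> \<le> 8" using sum_ln_over_square_le[of N] by simp
  finally show ?thesis .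
qed

text \<open>
  The terms missing from Mertens' sum are those at the powers of primes dividing \<open>m\<close>: either
  \<open>n\<close> is not prime, or it is one of the finitely many prime factors of \<open>m\<close>. The constant 9 is 1 from Mertens' bound and 8
  from the higher prime powers.
\<close>

lemma sum_mangoldt_coprime_ge:
  fixes m N :: nat
  assumes m: "m > 0" and N: "N > 0"
  shows "(\<Sum>n | n \<in> {1..N} \<and> coprime n m. mangoldt n / n)
           \<ge> ln N - 9 - (\<Sum>p\<in>prime_factors m. ln p / real p)"
proof -
  have "ln N - 1 \<le> (\<Sum>n=1..N. mangoldt n / real n)"
    using mertens_lower[OF N] by simp
  also have "\<dots> \<le> (\<Sum>n | n \<in> {1..N} \<and> coprime n m. mangoldt n / real n)
      + (\<Sum>n | n \<in> {1..N} \<and> \<not> coprime n m. mangoldt n / real n)"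
    by (subst sum.union_disjoint[symmetric]) (auto intro!: sum_mono2 simp: mangoldt_nonneg)
  also have "(\<Sum>n | n \<in> {1..N} \<and> \<not> coprime n m. mangoldt n / real n) \<le>
      (\<Sum>n\<in>{n. n \<in> {1..N} \<and> \<not> prime n} \<union> prime_factors m. mangoldt n / real n)"
  proof (intro sum_mono2)
    show "{n. n \<in> {1..N} \<and> \<not> coprime n m} \<subseteq> {n. n \<in> {1..N} \<and> \<not> prime n} \<union> prime_factors m"
      using m by (auto simp: prime_factors_dvd dest: prime_imp_coprime)
  qed (auto simp: mangoldt_nonneg)
  also have "\<dots> = (\<Sum>n | n \<in> {1..N} \<and> \<not> prime n. mangoldt n / real n) + (\<Sum>n\<in>prime_factors m. mangoldt n / real n)"
    by (intro sum.union_disjoint) auto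
  also have "\<dots> \<le> 8 + (\<Sum>p\<in>prime_factors m. ln p / real p)"
    using sum_mangoldt_nonprime_le by (intro add_mono sum_mono) (auto simp: in_prime_factors_iff)
  finally show ?thesis by simp
qed


section \<open>Primes in arithmetic progressions\<close>

lemma dchars_select_class:
  assumes m: "m > 0" and r: "[r * s = 1] (mod m)"
  shows "(\<Sum>\<chi>\<in>dchars m. \<chi> s * \<chi> n) = (if [n = r] (mod m) then of_nat (card (dchars m)) else 0)"
proof -
  have rs: "coprime r m" "coprime s m"
    using cong_imp_coprime[OF cong_sym[OF r]] by auto
  have iff: "[n = r] (mod m) \<longleftrightarrow> [s * n = 1] (mod m)"
  proof
    assume "[n = r] (mod m)"
    hence "[s * n = s * r] (mod m)" by (rule cong_scalar_left)
    thus "[s * n = 1] (mod m)" using r by (metis cong_trans mult.commute)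
  next
    assume "[s * n = 1] (mod m)"
    hence "[s * n = s * r] (mod m)" using r by (metis cong_sym cong_trans mult.commute)
    thus "[n = r] (mod m)" using rs(2) by (metis cong_mult_lcancel_nat)
  qed
  have "(\<Sum>\<chi>\<in>dchars m. \<chi> s * \<chi> n) = (\<Sum>\<chi>\<in>dchars m. \<chi> (s * n))"
    by (intro sum.cong) (auto simp: dchars_mult)
  also have "\<dots> = (if [s * n = 1] (mod m) then of_nat (card (dchars m)) else 0)"
  proof (cases "coprime n m")
    case True
    thus ?thesis using rs m by (intro dchars_orthogonality) auto
  next
    case False
    hence *: "\<not> coprime (s * n) m" by simp
    hence "\<not> [s * n = 1] (mod m)"
      using cong_imp_coprime[OF cong_sym, of "s * n" 1 m] by auto
    moreover have "(\<Sum>\<chi>\<in>dchars m. \<chi> (s * n)) = 0"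
      using * dchars_eq_0_iff by (intro sum.neutral) blast
    ultimately show ?thesis by simp
  qed
  finally show ?thesis unfolding iff .
qed

text \<open>
  The real part of the orthogonality relation, summed against \<open>\<Lambda>(n)/n\<close>. The factor \<open>\<chi> s\<close> with
  \<open>r s \<equiv> 1\<close> plays the role of the conjugate of \<open>\<chi> r\<close>.
\<close>

lemma sum_mangoldt_progression_ge:
  fixes m r :: nat
  assumes m: "m > 0" and r: "coprime r m"
  shows "\<exists>c C :: real. c > 0 \<and>
    (\<forall>N>0. (\<Sum>n | n \<in> {1..N::nat} \<and> [n = r] (mod m). mangoldt n / n) \<ge> c * ln N - C)"
proof -
  obtain s where s: "[r * s = 1] (mod m)" using cong_solve_coprime_nat[OF r] by auto
  have cs: "coprime s m" using cong_imp_coprime[OF cong_sym[OF s]] by auto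
  define h where "h = card (dchars m)"
  have h: "h > 0"
    unfolding h_def using principal_char_in_dchars finite_dchars[OF m] by (auto simp: card_gt_0_iff)
  define A where "A = (\<lambda>\<chi>::nat\<Rightarrow>complex. \<lambda>N. \<Sum>n=1..N. \<chi> n * mangoldt n / of_nat n)"
  let ?X = "dchars m - {principal_char m}"
  have "\<forall>\<chi>\<in>?X. \<exists>C. \<forall>N. norm (A \<chi> N) \<le> C"
  proof
    fix \<chi> assume "\<chi> \<in> ?X"
    hence \<chi>: "\<chi> \<in> dchars m" "\<chi> \<noteq> principal_char m" by auto
    interpret osc: oscillating \<chi> "2 * m" by (rule oscillating_dchars[OF \<chi> m])
    show "\<exists>C. \<forall>N. norm (A \<chi> N) \<le> C"
      using osc.Lambda_sum_bounded[OF nonprincipal_L_nonzero[OF \<chi> m]] unfolding A_def osc.Lambda_sum_def .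
  qed
  then obtain D where D: "\<forall>\<chi>\<in>?X. \<forall>N. norm (A \<chi> N) \<le> D \<chi>"
    by (rule bchoice[THEN exE])
  define E where "E = (\<Sum>p\<in>prime_factors m. ln p / real p)"
  have "h * (\<Sum>n | n \<in> {1..N} \<and> [n = r] (mod m). mangoldt n / n) \<ge> ln N - 9 - E - (\<Sum>\<chi>\<in>?X. D \<chi>)"
    if N: "N > 0" for N :: nat
  proof -
    have "of_real (h * (\<Sum>n | n \<in> {1..N} \<and> [n = r] (mod m). mangoldt n / n)) =
          (\<Sum>n | n \<in> {1..N} \<and> [n = r] (mod m). of_nat h * (mangoldt n / of_nat n :: complex))"
      by (simp add: sum_distrib_left)
    also have "\<dots> = (\<Sum>n=1..N. (\<Sum>\<chi>\<in>dchars m. \<chi> s * \<chi> n) * (mangoldt n / of_nat n))"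
      unfolding dchars_select_class[OF m s]
      by (intro sum.mono_neutral_cong_left) (auto simp: h_def)
    also have "\<dots> = (\<Sum>\<chi>\<in>dchars m. \<chi> s * A \<chi> N)"
      unfolding A_def sum_distrib_right sum_distrib_left by (subst sum.swap) (simp add: mult_ac)
    also have "\<dots> = A (principal_char m) N + (\<Sum>\<chi>\<in>?X. \<chi> s * A \<chi> N)"
      using finite_dchars[OF m] principal_char_in_dchars[of m] cs
      by (subst sum.remove[of _ "principal_char m"]) (auto simp: principal_char_def)
    finally have "h * (\<Sum>n | n \<in> {1..N} \<and> [n = r] (mod m). mangoldt n / n) =
        Re (A (principal_char m) N) + Re (\<Sum>\<chi>\<in>?X. \<chi> s * A \<chi> N)"
      by (auto dest!: arg_cong[where f = Re] simp only: Re_complex_of_real plus_complex.sel)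
    moreover have "Re (A (principal_char m) N) \<ge> ln N - 9 - E"
    proof -
      have "A (principal_char m) N = of_real (\<Sum>n | n \<in> {1..N} \<and> coprime n m. mangoldt n / n)"
        unfolding A_def of_real_sum by (intro sum.mono_neutral_cong_right) (auto simp: principal_char_def)
      thus ?thesis using sum_mangoldt_coprime_ge[OF m N] by (simp add: E_def)
    qed
    moreover have "Re (\<Sum>\<chi>\<in>?X. \<chi> s * A \<chi> N) \<ge> - (\<Sum>\<chi>\<in>?X. D \<chi>)"
    proof -
      have "norm (\<Sum>\<chi>\<in>?X. \<chi> s * A \<chi> N) \<le> (\<Sum>\<chi>\<in>?X. norm (\<chi> s * A \<chi> N))"
        by (rule norm_sum)
      also have "\<dots> \<le> (\<Sum>\<chi>\<in>?X. D \<chi>)"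
        using D norm_dchars[OF _ m cs] by (intro sum_mono) (auto simp: norm_mult)
      finally show ?thesis
        using abs_Re_le_cmod[of "\<Sum>\<chi>\<in>?X. \<chi> s * A \<chi> N"] by linarith
    qed
    ultimately show ?thesis by linarith
  qed
  hence "(\<Sum>n | n \<in> {1..N} \<and> [n = r] (mod m). mangoldt n / n) \<ge> 1 / h * ln N - (9 + E + (\<Sum>\<chi>\<in>?X. D \<chi>)) / h"
    if "N > 0" for N :: nat
    using that h by (simp add: field_simps)
  thus ?thesis using h by (intro exI[of _ "1 / h"] exI[of _ "(9 + E + (\<Sum>\<chi>\<in>?X. D \<chi>)) / h"]) auto
qed

text \<open>
  If the sum converged, beyond some \<open>N0\<close> it would be less than \<open>c / 2\<close>, and \<open>\<Sum>ln p / p\<close> over the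
  primes of the class up to \<open>N\<close> would be at most \<open>(c / 2) ln N + O(1)\<close>, which is too small.
\<close>

lemma prime_reciprocals_progression_diverge:
  fixes m r :: nat
  assumes m: "m > 0" and r: "coprime r m"
  shows "\<exists>P. finite P \<and> P \<subseteq> {p. prime p \<and> [p = r] (mod m)} \<and> (\<Sum>p\<in>P. 1 / real p) > M"
proof (rule ccontr)
  assume *: "\<not> ?thesis"
  define T where "T = {p. prime p \<and> [p = r] (mod m)}"
  define f where "f = (\<lambda>n. if n \<in> T then 1 / real n else 0)"
  obtain c C where c: "c > 0" and
    lower: "\<And>N :: nat. N > 0 \<Longrightarrow> (\<Sum>n | n \<in> {1..N} \<and> [n = r] (mod m). mangoldt n / n) \<ge> c * ln N - C"
    using sum_mangoldt_progression_ge[OF m r] by blast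
  have "summable f"
  proof (rule summableI_nonneg_bounded)
    fix n
    have "sum f {..<n} = (\<Sum>p\<in>{..<n} \<inter> T. 1 / real p)"
      unfolding f_def by (simp add: sum.inter_restrict)
    also have "\<dots> \<le> M" using * by (auto simp: T_def not_less)
    finally show "sum f {..<n} \<le> M" .
  qed (auto simp: f_def)
  then obtain N0 where N0: "\<And>n. norm (sum f {N0..<n}) < c / 2"
    using c unfolding summable_Cauchy by (metis order_refl half_gt_zero)
  have upper: "c * ln N - C \<le> 8 + (\<Sum>p<N0. ln p * f p) + ln N * (c / 2)" if N: "N > 0" for N :: nat
  proof -
    have "c * ln N - C \<le> (\<Sum>n | n \<in> {1..N} \<and> [n = r] (mod m). mangoldt n / n)"
      using lower N by simp
    also have "\<dots> \<le> (\<Sum>n\<in>{n. n \<in> {1..N} \<and> \<not> prime n} \<union> ({1..N} \<inter> T). mangoldt n / n)"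
      by (intro sum_mono2) (auto simp: T_def mangoldt_nonneg)
    also have "\<dots> = (\<Sum>n | n \<in> {1..N} \<and> \<not> prime n. mangoldt n / n) + (\<Sum>n\<in>{1..N} \<inter> T. mangoldt n / n)"
      by (intro sum.union_disjoint) (auto simp: T_def)
    also have "\<dots> \<le> 8 + (\<Sum>n\<in>{1..N} \<inter> T. mangoldt n / n)"
      by (intro add_right_mono sum_mangoldt_nonprime_le)
    also have "(\<Sum>n\<in>{1..N} \<inter> T. mangoldt n / n) = (\<Sum>p=1..N. ln p * f p)"
      unfolding f_def by (intro sum.mono_neutral_cong_left) (auto simp: T_def)
    also have "\<dots> \<le> (\<Sum>p\<in>{..<N0} \<union> {N0..<Suc N}. ln p * f p)"
      by (intro sum_mono2) (auto simp: f_def not_less_eq_eq)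
    also have "\<dots> = (\<Sum>p<N0. ln p * f p) + (\<Sum>p\<in>{N0..<Suc N}. ln p * f p)"
      by (intro sum.union_disjoint) auto
    also have "(\<Sum>p\<in>{N0..<Suc N}. ln p * f p) \<le> (\<Sum>p\<in>{N0..<Suc N}. ln N * f p)"
    proof (intro sum_mono)
      fix p assume p: "p \<in> {N0..<Suc N}"
      show "ln p * f p \<le> ln N * f p"
      proof (cases "p \<in> T")
        case True
        hence "p > 0" by (auto simp: T_def prime_gt_0_nat)
        thus ?thesis using p by (intro mult_right_mono) (auto simp: f_def)
      qed (simp add: f_def)
    qed
    also have "\<dots> \<le> ln N * (c / 2)"
      unfolding sum_distrib_left[symmetric] using N0[of "Suc N"] N
      by (intro mult_left_mono) (auto simp del: sum.op_ivl_Suc)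
    finally show ?thesis by linarith
  qed
  define D where "D = 2 * (C + 8 + (\<Sum>p<N0. ln p * f p)) / c"
  have "ln N \<le> D" if "N > 0" for N :: nat
    using upper[OF that] c by (simp add: D_def field_simps)
  moreover obtain N :: nat where N: "exp D < N" using reals_Archimedean2 by blast
  moreover from N have "real N > 0" using exp_gt_zero[of D] by linarith
  moreover from N this have "D < ln N" using ln_less_cancel_iff[of "exp D" N] by simp
  ultimately show False by (metis of_nat_0_less_iff not_less)
qed


section \<open>Sieving by finitely many primes\<close>

text \<open>
  Each block of \<open>Q\<close> consecutive integers contains \<open>\<phi>(Q)\<close> numbers prime to \<open>Q\<close>.
\<close>

lemma card_coprime_le:
  assumes "Q > 0"
  shows "card {n \<in> {1..N}. coprime n Q} \<le> (N div Q + 1) * totient Q"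
proof -
  have block: "card {n \<in> {0<..q * Q}. coprime n Q} = q * totient Q" for q
  proof (induction q)
    case (Suc q)
    have "{n \<in> {0<..Suc q * Q}. coprime n Q} =
          {n \<in> {0<..q * Q}. coprime n Q} \<union> (\<lambda>k. k + q * Q) ` totatives Q"
    proof (intro equalityI subsetI)
      fix n assume n: "n \<in> {n \<in> {0<..Suc q * Q}. coprime n Q}"
      show "n \<in> {n \<in> {0<..q * Q}. coprime n Q} \<union> (\<lambda>k. k + q * Q) ` totatives Q"
      proof (cases "n \<le> q * Q")
        case False
        hence n': "n = (n - q * Q) + q * Q" by simp
        moreover have "coprime (n - q * Q) Q"
          using n n'
          by (metis (lifting) coprime_iff_gcd_eq_1 gcd_add_mult mem_Collect_eq add.commute gcd.commute)
        hence "n - q * Q \<in> totatives Q"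
          using n False by (auto simp: in_totatives_iff)
        ultimately show ?thesis by blast
      qed (use n in auto)
    next
      fix n assume "n \<in> {n \<in> {0<..q * Q}. coprime n Q} \<union> (\<lambda>k. k + q * Q) ` totatives Q"
      thus "n \<in> {n \<in> {0<..Suc q * Q}. coprime n Q}"
      proof
        assume "n \<in> (\<lambda>k. k + q * Q) ` totatives Q"
        then obtain k where k: "n = k + q * Q" "k \<in> totatives Q" by blast
        hence "coprime n Q"
          by (metis (lifting) coprime_iff_gcd_eq_1 gcd_add_mult in_totatives_iff add.commute gcd.commute)
        thus ?thesis using k by (auto simp: in_totatives_iff)
      qed auto
    qed
    moreover have "card ((\<lambda>k. k + q * Q) ` totatives Q) = totient Q"
      by (subst card_image) (auto simp: totient_def inj_on_def)
    moreover have "{n \<in> {0<..q * Q}. coprime n Q} \<inter> (\<lambda>k. k + q * Q) ` totatives Q = {}"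
      by (auto simp: in_totatives_iff)
    ultimately show ?case
      using Suc by (subst card_Un_disjoint[THEN trans] | simp)+
  qed simp
  have "N \<le> (N div Q + 1) * Q"
    using div_mult_mod_eq[of N Q] mod_less_divisor[OF assms, of N] unfolding add_mult_distrib by linarith
  hence "card {n \<in> {1..N}. coprime n Q} \<le> card {n \<in> {0<..(N div Q + 1) * Q}. coprime n Q}"
    by (intro card_mono) auto
  thus ?thesis using block[of "N div Q + 1"] by (rule order.trans[OF _ eq_refl])
qed

lemma totient_prod_primes_le:
  assumes "finite P" "\<And>p. p \<in> P \<Longrightarrow> prime p"
  shows "totient (\<Prod>P) / real (\<Prod>P) \<le> exp (- (\<Sum>p\<in>P. 1 / real p))"
proof -
  have "totient (\<Prod>p\<in>P. p) = (\<Prod>p\<in>P. totient p)"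
    using assms by (intro totient_prod_coprime) (auto simp: pairwise_def intro!: primes_coprime)
  hence "real (totient (\<Prod>P)) / real (\<Prod>P) = (\<Prod>p\<in>P. real (totient p) / real p)"
    by (simp add: prod_dividef)
  also have "\<dots> \<le> (\<Prod>p\<in>P. exp (- (1 / real p)))"
  proof (intro prod_mono conjI)
    fix p assume "p \<in> P"
    hence p: "prime p" using assms by blast
    hence "real (totient p) / real p = 1 + (- (1 / real p))"
      using prime_gt_0_nat[OF p] by (simp add: totient_prime of_nat_diff Suc_le_eq field_simps)
    thus "real (totient p) / real p \<le> exp (- (1 / real p))"
      using exp_ge_add_one_self[of "- (1 / real p)"] by simp
  qed auto
  also have "\<dots> = exp (- (\<Sum>p\<in>P. 1 / real p))"
    by (simp add: exp_sum[OF assms(1)] sum_negf[symmetric])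
  finally show ?thesis .
qed

lemma density_zero_of_divergent_prime_reciprocals:
  assumes primes: "\<And>p. p \<in> T \<Longrightarrow> prime p"
    and diverge: "\<And>M. \<exists>P. finite P \<and> P \<subseteq> T \<and> (\<Sum>p\<in>P. 1 / real p) > M"
    and B: "\<And>n. n \<in> B \<Longrightarrow> n > 0 \<and> (\<forall>p\<in>T. \<not> p dvd n)"
  shows "has_natural_density B 0"
  unfolding has_natural_density_def
proof (rule tendstoI)
  fix e :: real assume e: "e > 0"
  obtain P where P: "finite P" "P \<subseteq> T" "(\<Sum>p\<in>P. 1 / real p) > - ln (e / 2)"
    using diverge by blast
  define Q where "Q = \<Prod>P"
  have Q: "Q > 0" using P primes by (auto simp: Q_def prime_gt_0_nat subset_iff intro!: prod_pos)
  have "totient Q / real Q \<le> exp (- (\<Sum>p\<in>P. 1 / real p))"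
    unfolding Q_def using P primes by (intro totient_prod_primes_le) auto
  also have "\<dots> < exp (ln (e / 2))" using P(3) by simp
  finally have small: "totient Q / real Q < e / 2" using e by simp
  have "dist (counting B x / x) 0 < e" if x: "x > 2 * totient Q / e" "x > 0" for x
  proof -
    define N where "N = nat \<lfloor>x\<rfloor>"
    have "{t \<in> B. real t \<le> x} \<subseteq> {n \<in> {1..N}. coprime n Q}"
    proof
      fix t assume t: "t \<in> {t \<in> B. real t \<le> x}"
      hence "t > 0" "\<And>p. p \<in> P \<Longrightarrow> \<not> p dvd t" using B P by auto
      hence "coprime t Q"
        unfolding Q_def using primes P by (intro prod_coprime_right)
          (metis coprime_commute prime_imp_coprime subsetD)
      thus "t \<in> {n \<in> {1..N}. coprime n Q}"
        using t \<open>t > 0\<close> by (auto simp: N_def le_nat_iff le_floor_iff)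
    qed
    hence "counting B x \<le> card {n \<in> {1..N}. coprime n Q}"
      unfolding counting_def by (intro card_mono) auto
    also have "\<dots> \<le> (N div Q + 1) * totient Q" by (rule card_coprime_le[OF Q])
    finally have "real (counting B x) \<le> (real (N div Q) + 1) * totient Q"
      by (metis of_nat_1 of_nat_add of_nat_le_iff of_nat_mult)
    also have "\<dots> \<le> (x / Q + 1) * totient Q"
    proof (intro mult_right_mono add_right_mono)
      have "real (N div Q) \<le> real N / Q" by (rule of_nat_div_le_of_nat)
      also have "\<dots> \<le> x / Q" using x by (intro divide_right_mono) (auto simp: N_def)
      finally show "real (N div Q) \<le> x / Q" .
    qed auto
    finally have "counting B x / x \<le> totient Q / Q + totient Q / x"
      using x by (simp add: field_simps)
    also have "totient Q / x < e / 2" using x e by (simp add: field_simps)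
    finally have "counting B x / x < e" using small by linarith
    thus ?thesis using x by simp
  qed
  thus "\<forall>\<^sub>F x in at_top. dist (counting B x / x) 0 < e"
    using eventually_gt_at_top[of "max (2 * totient Q / e) 0"] by (auto elim: eventually_mono)
qed

theorem theorem1p2:
  fixes r m :: nat
  assumes "r > 0" and "m > 0" and "coprime r m"
  shows "has_natural_density
    {n :: nat. n > 0 \<and> squarefree n \<and> (\<forall>p. prime p \<and> [p = r] (mod m) \<longrightarrow> \<not> p dvd n)} 0"
  by (rule density_zero_of_divergent_prime_reciprocals[OF _
        prime_reciprocals_progression_diverge[OF assms(2,3)]]) auto

end
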